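(* Let $v(x)=v_\epsilon(x)\ge0$, $x\in\mathcal X$, satisfy $v(x)=\Theta(\epsilon^{\bar d(x,g)})$ uniformly in $x$, and let $\mathbb Q$ be the path measure built from $v$ and $L_{\mathbb Q}=\mathbb P/\mathbb Q$ the likelihood ratio (see context). Then the estimator based on $v$ and $\mathbb Q$ has bounded relative error: $$\frac{\operatorname{Var}_{\mathbb Q}(L_{\mathbb Q}\cdot\mathbf 1_\Phi)}{\big(\mathbb E_{\mathbb Q}(L_{\mathbb Q}\cdot\mathbf 1_\Phi)\big)^2}=O(1)\qquad(\epsilon\downarrow0).$$
   Context: Markov chain. $\mathcal X$ is a (possibly infinite) countable state space with distinguished states $s$ (initial), $g$ (goal), $t$ (taboo), $s\ne g$, $s\neq t$, and $g,t$ absorbing ($p_{gg}=p_{tt}=1$). The transition probabilities $p_{xz}=p_{xz}(\epsilon)$ depend on a small parameter $\epsilon>0$; for each $x,z$ either $p_{xz}=0$, and then $r_{xz}=\infty$, or $p_{xz}(\epsilon)>0$ with $p_{xz}(\epsilon)=\Theta(\epsilon^{r_{xz}})$ for some $r_{xz}\in\mathbb N=\{0,1,2,\dots\}$. The state space and its transition structure do not depend on $\epsilon$. Asymptotics. $f=\Theta(h)$ means $0<\lim_{\epsilon\downarrow0}f(\epsilon)/h(\epsilon)<\infty$; $f=O(h)$ means $\lim_{\epsilon\downarrow0}f(\epsilon)/h(\epsilon)<\infty$. $f_y=\Theta(h_y)$ uniformly in $y$ means there are $a,b>0$ with $a<\lim_{\epsilon\downarrow0}f_y(\epsilon)/h_y(\epsilon)<b$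 for all $y$ (limits assumed to exist). Convention: $\epsilon^\infty=0$, and $f=\Theta(\epsilon^\infty)$ means $f(\epsilon)=0$ for all small $\epsilon$ (such indices are exempt from the bounds $a,b$). Paths. A path $\omega$ is a finite sequence $\omega(0),\dots,\omega(n_\omega)$ of states, with $n_\omega\ge0$ steps, and $\mathbb P(\omega)=\prod_{i=1}^{n_\omega}p_{\omega(i-1)\omega(i)}$. Distance: $d(x,z)$ is the minimum of those $r\in\mathbb N$ for which there is a path $\omega$ with $\omega(0)=x$, $\omega(n_\omega)=z$, $\omega(k)\notin\{t,g\}$ for all $k<n_\omega$, and $\mathbb P(\omega)=\Theta(\epsilon^r)$; $d(x,z)=\infty$ if there is none. $\Phi(x)$ is the set of paths with $\omega(0)=x$, $\omega(n_\omega)=g$, $\omega(k)\notin\{t,g\}$ for $k<n_\omega$; $\Phi=\Phi(s)$. Sets. $\Lambda=\{x\in\mathcal X: d(s,x)\le d(s,g)\}$, $\Gamma=\{x\in\mathcal X\setminus\Lambda:\exists z\in\Lambda,\ p_{zx}>0\}$. Modified chain: $\bar p_{xz}=p_{xz}$ if $x\notin\Gamma$; $\bar p_{xg}=1$ and $\bar p_{xz}=0$ for $z\ne g$ if $x\in\Gamma$. $\bar{\mathbb P}$ and $\bar d$ are defined as $\mathbb P$ and $d$ with $\bar p$ in place of $p$. Importance sampling measure. For a path $\omega$ let $m(\omega)=\min\{i:\omega(i)\notin\Lambda\text{ or }\omega(i)=g\}$ ($=\infty$ if there is no such $i$). Then $\mathbb Q(\omega)=\prod_{i=0}^{n_\omega-1}q_{\omega(i)\omega(i+1)}$,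 where $q_{\omega(i)\omega(i+1)}=\bar p_{\omega(i)\omega(i+1)}v(\omega(i+1))\big/\sum_{z\in\mathcal X}\bar p_{\omega(i)z}v(z)$ if $i<m(\omega)$, and $q_{\omega(i)\omega(i+1)}=p_{\omega(i)\omega(i+1)}$ if $i\ge m(\omega)$. (A path entering, before $m(\omega)$, a state where the denominator vanishes has $\mathbb Q(\omega)=0$.) A random path is drawn under $\mathbb Q$ from $s$ until it first hits $g$ or $t$; $\mathbf 1_\Phi$ indicates that it hits $g$; $L_{\mathbb Q}(\omega)=\mathbb P(\omega)/\mathbb Q(\omega)$. Expectation and variance under $\mathbb Q$ refer to this random path; e.g. $\mathbb E_{\mathbb Q}(L_{\mathbb Q}^k\mathbf 1_\Phi)=\sum_{\omega\in\Phi,\ \mathbb Q(\omega)>0}\mathbb Q(\omega)(\mathbb P(\omega)/\mathbb Q(\omega))^k$. Standing assumptions. $\Lambda$ and $\Gamma$ are finite; $d(s,g)<\infty$; under $\mathbb P$ the chain from $s$ reaches $\{t,g\}$ in finite time with probability 1; the chain has no high-probability cycle, i.e. no path with $n_\omega\ge1$, $\omega(n_\omega)=\omega(0)$ and $\mathbb P(\omega)=\Theta(\epsilon^0)$, other than the self-loops at the absorbing states $g,t$. *)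

theory Defs
  imports "HOL-Probability.Probability"
begin

text \<open>
  All asymptotics are for \<open>\<epsilon> \<down> 0\<close>, i.e. along the filter \<open>at_right 0\<close>.  The big-O used here
  demands, as in the source, that the limit of the quotient exists and is finite; this is more than
  boundedness of the quotient.
\<close>

definition is_Theta :: "(real \<Rightarrow> real) \<Rightarrow> (real \<Rightarrow> real) \<Rightarrow> bool" where
  "is_Theta f h \<longleftrightarrow> (\<exists>c>0. ((\<lambda>\<epsilon>. f \<epsilon> / h \<epsilon>) \<longlongrightarrow> c) (at_right 0))"

definition is_bigO :: "(real \<Rightarrow> real) \<Rightarrow> (real \<Rightarrow> real) \<Rightarrow> bool" where
  "is_bigO f h \<longleftrightarrow> (\<exists>c. ((\<lambda>\<epsilon>. f \<epsilon> / h \<epsilon>) \<longlongrightarrow> c) (at_right 0))"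

text \<open>
  \<open>f y = \<Theta>(\<epsilon> ^ d y)\<close> uniformly in \<open>y\<close>.  Indices with \<open>d y = \<infinity>\<close> are exempt from the bounds
  \<open>a, b\<close>, and the range on which \<open>f y\<close> vanishes may depend on \<open>y\<close>.
\<close>

definition uniform_Theta_pow :: "('b \<Rightarrow> real \<Rightarrow> real) \<Rightarrow> ('b \<Rightarrow> enat) \<Rightarrow> bool" where
  "uniform_Theta_pow f d \<longleftrightarrow> (\<exists>a>0. \<exists>b>0. \<forall>y. case d y of
       enat n \<Rightarrow> (\<exists>c. a < c \<and> c < b \<and> ((\<lambda>\<epsilon>. f y \<epsilon> / \<epsilon> ^ n) \<longlongrightarrow> c) (at_right 0))
     | \<infinity> \<Rightarrow> (\<forall>\<^sub>F \<epsilon> in at_right 0. f y \<epsilon> = 0))"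

text \<open>
  A path is a nonempty list of states; \<open>\<omega>(k)\<close> is \<open>\<omega> ! k\<close>.  A family of transition matrices is
  a function \<open>p\<close> where \<open>p \<epsilon> x z\<close> is the probability of going from \<open>x\<close> to \<open>z\<close>.
\<close>

definition steps :: "'a list \<Rightarrow> nat" where
  "steps \<omega> = length \<omega> - 1"

definition path_prob :: "('a \<Rightarrow> 'a \<Rightarrow> real) \<Rightarrow> 'a list \<Rightarrow> real" where
  "path_prob P \<omega> = (\<Prod>i<steps \<omega>. P (\<omega> ! i) (\<omega> ! Suc i))"

definition paths_between :: "'a \<Rightarrow> 'a \<Rightarrow> 'a \<Rightarrow> 'a \<Rightarrow> 'a list set" where
  "paths_between g t x z =
     {\<omega>. \<omega> \<noteq> [] \<and> hd \<omega> = x \<and> last \<omega> = z \<and> (\<forall>k<steps \<omega>. \<omega> ! k \<notin> {t, g})}"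

definition dist_states ::
    "(real \<Rightarrow> 'a \<Rightarrow> 'a \<Rightarrow> real) \<Rightarrow> 'a \<Rightarrow> 'a \<Rightarrow> 'a \<Rightarrow> 'a \<Rightarrow> enat" where
  "dist_states p g t x z = Inf {enat r | r.
     \<exists>\<omega>\<in>paths_between g t x z. is_Theta (\<lambda>\<epsilon>. path_prob (p \<epsilon>) \<omega>) (\<lambda>\<epsilon>. \<epsilon> ^ r)}"

definition Phi :: "'a \<Rightarrow> 'a \<Rightarrow> 'a \<Rightarrow> 'a list set" where
  "Phi s g t = paths_between g t s g"

definition Lambda :: "(real \<Rightarrow> 'a \<Rightarrow> 'a \<Rightarrow> real) \<Rightarrow> 'a \<Rightarrow> 'a \<Rightarrow> 'a \<Rightarrow> 'a set" where
  "Lambda p s g t = {x. dist_states p g t s x \<le> dist_states p g t s g}"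

text \<open>Positivity of a transition probability does not depend on small \<open>\<epsilon>\<close>
  (see the locale below), hence the \<open>\<epsilon>\<close>-free formulation.\<close>

definition Gamma_set :: "(real \<Rightarrow> 'a \<Rightarrow> 'a \<Rightarrow> real) \<Rightarrow> 'a \<Rightarrow> 'a \<Rightarrow> 'a \<Rightarrow> 'a set" where
  "Gamma_set p s g t =
     {x. x \<notin> Lambda p s g t \<and> (\<exists>z\<in>Lambda p s g t. \<forall>\<^sub>F \<epsilon> in at_right 0. p \<epsilon> z x > 0)}"

definition p_bar ::
    "(real \<Rightarrow> 'a \<Rightarrow> 'a \<Rightarrow> real) \<Rightarrow> 'a \<Rightarrow> 'a \<Rightarrow> 'a \<Rightarrow> real \<Rightarrow> 'a \<Rightarrow> 'a \<Rightarrow> real" where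
  "p_bar p s g t \<epsilon> x z =
     (if x \<in> Gamma_set p s g t then (if z = g then 1 else 0) else p \<epsilon> x z)"

definition d_bar :: "(real \<Rightarrow> 'a \<Rightarrow> 'a \<Rightarrow> real) \<Rightarrow> 'a \<Rightarrow> 'a \<Rightarrow> 'a \<Rightarrow> 'a \<Rightarrow> 'a \<Rightarrow> enat" where
  "d_bar p s g t = dist_states (p_bar p s g t) g t"

text \<open>Paths from \<open>s\<close> up to the first visit to \<open>{g, t}\<close>.\<close>

definition absorbed_paths :: "'a \<Rightarrow> 'a \<Rightarrow> 'a \<Rightarrow> 'a list set" where
  "absorbed_paths s g t = paths_between g t s g \<union> paths_between g t s t"

text \<open>
  Absorption with probability 1 is expressed through the first-passage decomposition.  In
  \<open>no_hp_cycle\<close>, the constant paths at \<open>g\<close> and at \<open>t\<close> are the (possibly repeated) self-loops at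
  the absorbing states.
\<close>

locale rare_event_chain =
  fixes p :: "real \<Rightarrow> 'a :: countable \<Rightarrow> 'a \<Rightarrow> real"
    and \<epsilon>0 :: real
    and r :: "'a \<Rightarrow> 'a \<Rightarrow> enat"
    and s g t :: 'a
  assumes eps0_pos: "\<epsilon>0 > 0"
    and s_neq_g: "s \<noteq> g"
    and s_neq_t: "s \<noteq> t"
    and p_nonneg: "\<And>\<epsilon> x z. \<epsilon> \<in> {0<..<\<epsilon>0} \<Longrightarrow> p \<epsilon> x z \<ge> 0"
    and p_stochastic: "\<And>\<epsilon> x. \<epsilon> \<in> {0<..<\<epsilon>0} \<Longrightarrow> (p \<epsilon> x has_sum 1) UNIV"
    and g_absorbing: "\<And>\<epsilon>. \<epsilon> \<in> {0<..<\<epsilon>0} \<Longrightarrow> p \<epsilon> g g = 1"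
    and t_absorbing: "\<And>\<epsilon>. \<epsilon> \<in> {0<..<\<epsilon>0} \<Longrightarrow> p \<epsilon> t t = 1"
    and p_order: "\<And>x z. case r x z of
          \<infinity> \<Rightarrow> (\<forall>\<epsilon>\<in>{0<..<\<epsilon>0}. p \<epsilon> x z = 0)
        | enat n \<Rightarrow> (\<forall>\<epsilon>\<in>{0<..<\<epsilon>0}. p \<epsilon> x z > 0) \<and> is_Theta (\<lambda>\<epsilon>. p \<epsilon> x z) (\<lambda>\<epsilon>. \<epsilon> ^ n)"
    and finite_Lambda: "finite (Lambda p s g t)"
    and finite_Gamma: "finite (Gamma_set p s g t)"
    and goal_reachable: "dist_states p g t s g < \<infinity>"
    and absorbed_as: "\<And>\<epsilon>. \<epsilon> \<in> {0<..<\<epsilon>0} \<Longrightarrow>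
          (path_prob (p \<epsilon>) has_sum 1) (absorbed_paths s g t)"
    and no_hp_cycle: "\<And>\<omega>. \<omega> \<noteq> [] \<Longrightarrow> steps \<omega> \<ge> 1 \<Longrightarrow> last \<omega> = hd \<omega> \<Longrightarrow>
          is_Theta (\<lambda>\<epsilon>. path_prob (p \<epsilon>) \<omega>) (\<lambda>\<epsilon>. \<epsilon> ^ 0) \<Longrightarrow> set \<omega> = {g} \<or> set \<omega> = {t}"

text \<open>\<open>Inf {} = \<infinity>\<close> in \<^typ>\<open>enat\<close>.\<close>

definition exit_index ::
    "(real \<Rightarrow> 'a \<Rightarrow> 'a \<Rightarrow> real) \<Rightarrow> 'a \<Rightarrow> 'a \<Rightarrow> 'a \<Rightarrow> 'a list \<Rightarrow> enat" where
  "exit_index p s g t \<omega> =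
     Inf {enat i | i. i < length \<omega> \<and> (\<omega> ! i \<notin> Lambda p s g t \<or> \<omega> ! i = g)}"

text \<open>
  Where the denominator vanishes the factor is \<open>0\<close> by \<open>x / 0 = 0\<close>.  For
  \<open>i < exit_index p s g t \<omega>\<close> the state \<open>\<omega> ! i\<close> lies in \<open>Lambda p s g t\<close>, so under the locale
  assumptions the sum in the denominator has only finitely many nonzero terms.
\<close>

definition Q_prob ::
    "(real \<Rightarrow> 'a \<Rightarrow> 'a \<Rightarrow> real) \<Rightarrow> 'a \<Rightarrow> 'a \<Rightarrow> 'a \<Rightarrow> (real \<Rightarrow> 'a \<Rightarrow> real) \<Rightarrow> real \<Rightarrow> 'a list \<Rightarrow> real"
  where
  "Q_prob p s g t v \<epsilon> \<omega> = (\<Prod>i<steps \<omega>.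
     if enat i < exit_index p s g t \<omega>
     then p_bar p s g t \<epsilon> (\<omega> ! i) (\<omega> ! Suc i) * v \<epsilon> (\<omega> ! Suc i) /
            (\<Sum>\<^sub>\<infinity>z. p_bar p s g t \<epsilon> (\<omega> ! i) z * v \<epsilon> z)
     else p \<epsilon> (\<omega> ! i) (\<omega> ! Suc i))"

text \<open>
  The law under \<open>Q\<close> of the random path drawn from \<open>s\<close> until it hits \<open>{g, t}\<close>:
  \<open>Some \<omega>\<close> is the event that \<open>\<omega>\<close> is the path up to absorption, and \<open>None\<close> carries the remaining
  mass (no absorption).
\<close>

definition Q_law ::
    "(real \<Rightarrow> 'a \<Rightarrow> 'a \<Rightarrow> real) \<Rightarrow> 'a \<Rightarrow> 'a \<Rightarrow> 'a \<Rightarrow> (real \<Rightarrow> 'a \<Rightarrow> real) \<Rightarrow> real \<Rightarrow>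
      'a list option measure" where
  "Q_law p s g t v \<epsilon> = density (count_space UNIV) (\<lambda>y. case y of
       Some \<omega> \<Rightarrow> if \<omega> \<in> absorbed_paths s g t then ennreal (Q_prob p s g t v \<epsilon> \<omega>) else 0
     | None \<Rightarrow> 1 - (\<integral>\<^sup>+ \<omega>. ennreal (Q_prob p s g t v \<epsilon> \<omega>) \<partial>count_space (absorbed_paths s g t)))"

text \<open>The estimator \<open>L \<cdot> 1\<^sub>\<Phi>\<close> with likelihood ratio \<open>L = P / Q\<close>; paths with \<open>Q\<close>-probability
  \<open>0\<close> are null for \<open>Q_law\<close>.\<close>

definition IS_estimator ::
    "(real \<Rightarrow> 'a \<Rightarrow> 'a \<Rightarrow> real) \<Rightarrow> 'a \<Rightarrow> 'a \<Rightarrow> 'a \<Rightarrow> (real \<Rightarrow> 'a \<Rightarrow> real) \<Rightarrow> real \<Rightarrow>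
      'a list option \<Rightarrow> real" where
  "IS_estimator p s g t v \<epsilon> y = (case y of
       Some \<omega> \<Rightarrow> path_prob (p \<epsilon>) \<omega> / Q_prob p s g t v \<epsilon> \<omega> * indicator (Phi s g t) \<omega>
     | None \<Rightarrow> 0)"

end

theory Submission
  imports Defs
begin

text \<open>
  Write \<open>d\<close> for the distance from \<open>s\<close> to \<open>g\<close>.  Up to its exit from \<open>\<Lambda>\<close>, the likelihood ratio of a
  path telescopes to \<open>v(s) / v(exit)\<close> times the product of \<open>(\<Sum>z. p x z * v z) / v x\<close> over the visited
  states, and each of these factors converges.  Hence both the first moment and \<open>1 / v(s)\<close> times the
  second moment are sums over \<open>\<Phi>\<close> of weights that are products of \<open>O(\<epsilon> ^ r x y)\<close>.  Only the paths of
  cost exactly \<open>d\<close> contribute at order \<open>\<epsilon> ^ d\<close>; a path that leaves \<open>\<Lambda>\<close> before reaching \<open>g\<close> costs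
  at least \<open>d + 1\<close>.  As there is no cost-free cycle in the finite set \<open>\<Lambda>\<close>, the kernel
  \<open>D * \<delta> ^ r x y\<close> has, for small fixed \<open>\<delta>\<close>, a superharmonic function of the form
  \<open>M ^ rank x\<close>; this bounds the total weight of the paths of higher cost by \<open>O(\<epsilon> ^ (d + 1))\<close>.  So the
  first moment is \<open>c1 * \<epsilon> ^ d\<close> with \<open>c1 > 0\<close> and the second \<open>c2 * \<epsilon> ^ (2 * d)\<close>, to leading order.
\<close>

section \<open>Recursion and induction along paths\<close>

lemma path_prob_single [simp]: "path_prob P [x] = 1"
  by (simp add: path_prob_def steps_def)

lemma path_prob_Cons [simp]: "path_prob P (x # y # ys) = P x y * path_prob P (y # ys)"
proof -
  have "(\<Prod>i<Suc (length ys). P ((x # y # ys) ! i) ((x # y # ys) ! Suc i)) =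
        P x y * (\<Prod>i<length ys. P ((y # ys) ! i) ((y # ys) ! Suc i))"
    by (subst prod.lessThan_Suc_shift) simp
  then show ?thesis
    by (simp add: path_prob_def steps_def)
qed

lemma paths_between_Cons:
  "x # ys \<in> paths_between g t x' z \<longleftrightarrow>
     x = x' \<and> (if ys = [] then x = z else x \<notin> {t, g} \<and> ys \<in> paths_between g t (hd ys) z)"
proof (cases ys)
  case Nil
  then show ?thesis by (auto simp: paths_between_def steps_def)
next
  case (Cons y zs)
  have "(\<forall>k<Suc (length zs). (x # y # zs) ! k \<notin> {t, g}) \<longleftrightarrow>
        x \<notin> {t, g} \<and> (\<forall>k<length zs. (y # zs) ! k \<notin> {t, g})"
    by (auto simp: less_Suc_eq_0_disj)
  then show ?thesis
    using Cons by (auto simp: paths_between_def steps_def)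
qed

text \<open>The first state is peeled off while the end \<open>z\<close> stays fixed. This matches
  \<open>path_prob\<close>, \<open>stopped_cost\<close> and \<open>stopped_weight\<close>, which
  also consume the first state, and it starts from the absorbing end.\<close>

lemma paths_between_induct [consumes 1, case_names single step]:
  assumes "\<omega> \<in> paths_between g t x z"
    and "P [z]"
    and "\<And>x y ys. x \<notin> {t, g} \<Longrightarrow> y # ys \<in> paths_between g t y z \<Longrightarrow> P (y # ys) \<Longrightarrow> P (x # y # ys)"
  shows "P \<omega>"
  using assms(1)
proof (induction \<omega> arbitrary: x)
  case Nil
  then show ?case by (simp add: paths_between_def)
next
  case (Cons a ys)
  show ?case
  proof (cases ys)
    case Nil
    then show ?thesis using Cons.prems assms(2) by (auto simp: paths_between_Cons)
  next
    case (Cons y zs)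
    then show ?thesis
      using Cons.IH[of y] Cons.prems assms(3)[of a y zs] by (auto simp: paths_between_Cons)
  qed
qed

lemma paths_between_hd: "\<omega> \<in> paths_between g t x z \<Longrightarrow> hd \<omega> = x"
  by (simp add: paths_between_def)

section \<open>Costs and weights of paths stopped at a set\<close>

fun path_cost :: "('a \<Rightarrow> 'a \<Rightarrow> enat) \<Rightarrow> 'a list \<Rightarrow> enat" where
  "path_cost r (x # y # ys) = r x y + path_cost r (y # ys)"
| "path_cost r _ = 0"

fun stopped_cost :: "'a set \<Rightarrow> ('a \<Rightarrow> 'a \<Rightarrow> enat) \<Rightarrow> 'a list \<Rightarrow> enat" where
  "stopped_cost E r (x # y # ys) = (if x \<in> E then 0 else r x y + stopped_cost E r (y # ys))"
| "stopped_cost E r _ = 0"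

text \<open>Two regimes are kept apart: \<open>k\<close> weighs the single steps before the first
  visit to \<open>E\<close>, \<open>h\<close> weighs the whole rest of the path. Later
  \<open>E\<close> is the set of exits from \<open>\<Lambda>\<close>: steps inside the finite
  \<open>\<Lambda>\<close> are estimated one by one, and the rest only through its total
  probability, which is at most 1.\<close>

fun stopped_weight :: "'a set \<Rightarrow> ('a \<Rightarrow> 'a \<Rightarrow> real) \<Rightarrow> ('a list \<Rightarrow> real) \<Rightarrow> 'a list \<Rightarrow> real" where
  "stopped_weight E k h (x # y # ys) =
     (if x \<in> E then h (x # y # ys) else k x y * stopped_weight E k h (y # ys))"
| "stopped_weight E k h \<omega> = h \<omega>"

lemma stopped_weight_in [simp]: "x \<in> E \<Longrightarrow> stopped_weight E k h (x # ys) = h (x # ys)"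
  by (cases ys) auto

lemma stopped_cost_in [simp]: "x \<in> E \<Longrightarrow> stopped_cost E r (x # ys) = 0"
  by (cases ys) auto

lemma stopped_weight_path_prob: "stopped_weight E P (path_prob P) \<omega> = path_prob P \<omega>"
  by (induction E P "path_prob P" \<omega> rule: stopped_weight.induct) auto

lemma stopped_cost_le:
  assumes "\<And>x y. x \<notin> E \<Longrightarrow> r x y \<le> r' x y"
  shows "stopped_cost E r \<omega> \<le> path_cost r' \<omega>"
  using assms by (induction E r \<omega> rule: stopped_cost.induct) (auto intro: add_mono)

text \<open>Truncate the path at its first visit to \<open>E\<close>, which exists because the end
  \<open>g\<close> lies in \<open>E\<close>. If the truncated path ends in \<open>g\<close>, nothing
  was cut off, since \<open>g\<close> cannot occur before the last index; then \<open>E\<close> is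
  met at the end only.\<close>

lemma stopped_cost_path:
  assumes "\<omega> \<in> paths_between g t x g" "g \<in> E"
  shows "\<exists>z \<omega>'. z \<in> E \<and> \<omega>' \<in> paths_between g t x z \<and> path_cost r \<omega>' = stopped_cost E r \<omega> \<and>
           (z = g \<longrightarrow> set (butlast \<omega>) \<inter> E = {})"
proof -
  \<comment> \<open>The start is written as \<open>hd \<omega>\<close> because the induction
    predicate depends on the path only.\<close>
  have "\<exists>z \<omega>'. z \<in> E \<and> \<omega>' \<in> paths_between g t (hd \<omega>) z \<and> path_cost r \<omega>' = stopped_cost E r \<omega> \<and>
           (z = g \<longrightarrow> set (butlast \<omega>) \<inter> E = {})"
    using assms(1)
  proof (induction rule: paths_between_induct)
    case single
    show ?case
      by (intro exI[of _ g] exI[of _ "[g]"]) (simp add: assms paths_between_Cons)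
  next
    case (step x y ys)
    show ?case
    proof (cases "x \<in> E")
      case True
      with step show ?thesis
        by (intro exI[of _ x] exI[of _ "[x]"]) (auto simp add: paths_between_Cons)
    next
      case False
      from step obtain z \<omega>' where z: "z \<in> E" "\<omega>' \<in> paths_between g t y z"
        "path_cost r \<omega>' = stopped_cost E r (y # ys)" "z = g \<longrightarrow> set (butlast (y # ys)) \<inter> E = {}"
        by auto
      then obtain zs where zs: "\<omega>' = y # zs"
        by (cases \<omega>') (auto simp: paths_between_def)
      show ?thesis
        using z zs step False
        by (intro exI[of _ z] exI[of _ "x # \<omega>'"]) (auto simp: paths_between_Cons)
    qed
  qed
  then show ?thesis using assms(1) by (simp add: paths_between_def)
qed

section \<open>Orders of magnitude and the combinatorial form of the distance\<close>

lemma is_Theta_pow_unique: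
  assumes "is_Theta f (\<lambda>\<epsilon>. \<epsilon> ^ n)" "is_Theta f (\<lambda>\<epsilon>. \<epsilon> ^ m)"
  shows "n = m"
proof -
  \<comment> \<open>With \<open>n < m\<close>, the quotient by \<open>\<epsilon> ^ n\<close> is the
    quotient by \<open>\<epsilon> ^ m\<close> times a positive power of \<open>\<epsilon>\<close>,
    so it tends to 0 instead of a positive limit.\<close>
  have aux: False if "n < m" "is_Theta f (\<lambda>\<epsilon>. \<epsilon> ^ n)" "is_Theta f (\<lambda>\<epsilon>. \<epsilon> ^ m)" for n m
  proof -
    from that obtain a b where ab: "a > 0" "b > 0" "((\<lambda>\<epsilon>. f \<epsilon> / \<epsilon> ^ n) \<longlongrightarrow> a) (at_right 0)"
      "((\<lambda>\<epsilon>. f \<epsilon> / \<epsilon> ^ m) \<longlongrightarrow> b) (at_right 0)"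
      by (auto simp: is_Theta_def)
    have "((\<lambda>\<epsilon>::real. \<epsilon> ^ (m - n)) \<longlongrightarrow> 0 ^ (m - n)) (at_right 0)"
      by (intro tendsto_intros)
    then have "((\<lambda>\<epsilon>::real. \<epsilon> ^ (m - n)) \<longlongrightarrow> 0) (at_right 0)" using that by simp
    from tendsto_mult[OF ab(4) this] have "((\<lambda>\<epsilon>. f \<epsilon> / \<epsilon> ^ m * \<epsilon> ^ (m - n)) \<longlongrightarrow> 0) (at_right 0)" by simp
    moreover have "\<forall>\<^sub>F \<epsilon> in at_right 0. f \<epsilon> / \<epsilon> ^ m * \<epsilon> ^ (m - n) = f \<epsilon> / \<epsilon> ^ n"
      using eventually_at_right_less[of 0]
      by eventually_elim (use that in \<open>simp add: field_simps flip: power_add\<close>)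
    ultimately have "((\<lambda>\<epsilon>. f \<epsilon> / \<epsilon> ^ n) \<longlongrightarrow> 0) (at_right 0)"
      by (rule Lim_transform_eventually)
    with ab show False
      using tendsto_unique[of "at_right (0::real)" "\<lambda>\<epsilon>. f \<epsilon> / \<epsilon> ^ n" 0 a] by simp
  qed
  show ?thesis
    using aux[of n m] aux[of m n] assms by (meson linorder_neqE_nat)
qed

lemma is_Theta_nonzero:
  assumes "\<forall>\<^sub>F \<epsilon> in at_right 0. f \<epsilon> = 0"
  shows "\<not> is_Theta f h"
proof
  assume "is_Theta f h"
  then obtain c where c: "c > 0" "((\<lambda>\<epsilon>. f \<epsilon> / h \<epsilon>) \<longlongrightarrow> c) (at_right 0)"
    by (auto simp: is_Theta_def)
  have "((\<lambda>\<epsilon>. f \<epsilon> / h \<epsilon>) \<longlongrightarrow> 0) (at_right 0)"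
    by (rule tendsto_eventually) (use assms in eventually_elim, simp)
  with c show False
    using tendsto_unique[of "at_right (0::real)" "\<lambda>\<epsilon>. f \<epsilon> / h \<epsilon>" 0 c] by simp
qed

text \<open>Stated for an arbitrary kernel, so that everything about distances applies to both
  \<open>p\<close> and the modified kernel \<open>p_bar\<close>.\<close>

definition has_order :: "(real \<Rightarrow> 'a \<Rightarrow> 'a \<Rightarrow> real) \<Rightarrow> ('a \<Rightarrow> 'a \<Rightarrow> enat) \<Rightarrow> bool" where
  "has_order p r \<longleftrightarrow> (\<forall>x z. case r x z of
      \<infinity> \<Rightarrow> \<forall>\<^sub>F \<epsilon> in at_right 0. p \<epsilon> x z = 0
    | enat n \<Rightarrow> is_Theta (\<lambda>\<epsilon>. p \<epsilon> x z) (\<lambda>\<epsilon>. \<epsilon> ^ n))"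

lemma path_prob_order:
  assumes "has_order p r"
  shows "case path_cost r \<omega> of
      \<infinity> \<Rightarrow> \<forall>\<^sub>F \<epsilon> in at_right 0. path_prob (p \<epsilon>) \<omega> = 0
    | enat n \<Rightarrow> is_Theta (\<lambda>\<epsilon>. path_prob (p \<epsilon>) \<omega>) (\<lambda>\<epsilon>. \<epsilon> ^ n)"
  using assms
proof (induction r \<omega> rule: path_cost.induct)
  case (1 r x y ys)
  have IH: "case path_cost r (y # ys) of
      \<infinity> \<Rightarrow> \<forall>\<^sub>F \<epsilon> in at_right 0. path_prob (p \<epsilon>) (y # ys) = 0
    | enat n \<Rightarrow> is_Theta (\<lambda>\<epsilon>. path_prob (p \<epsilon>) (y # ys)) (\<lambda>\<epsilon>. \<epsilon> ^ n)"
    using 1 by blast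
  have o: "case r x y of
      \<infinity> \<Rightarrow> \<forall>\<^sub>F \<epsilon> in at_right 0. p \<epsilon> x y = 0
    | enat n \<Rightarrow> is_Theta (\<lambda>\<epsilon>. p \<epsilon> x y) (\<lambda>\<epsilon>. \<epsilon> ^ n)"
    using 1 by (simp add: has_order_def)
  consider "r x y = \<infinity>" | "path_cost r (y # ys) = \<infinity>"
    | n m where "r x y = enat n" "path_cost r (y # ys) = enat m"
    by (cases "r x y"; cases "path_cost r (y # ys)") auto
  then show ?case
  proof cases
    case 1
    then have "\<forall>\<^sub>F \<epsilon> in at_right 0. p \<epsilon> x y = 0" using o by simp
    then have "\<forall>\<^sub>F \<epsilon> in at_right 0. path_prob (p \<epsilon>) (x # y # ys) = 0"
      by eventually_elim simp
    then show ?thesis using 1 by simp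
  next
    case 2
    then have "\<forall>\<^sub>F \<epsilon> in at_right 0. path_prob (p \<epsilon>) (y # ys) = 0" using IH by simp
    then have "\<forall>\<^sub>F \<epsilon> in at_right 0. path_prob (p \<epsilon>) (x # y # ys) = 0"
      by eventually_elim simp
    then show ?thesis using 2 by simp
  next
    case 3
    then obtain c d where cd: "c > 0" "d > 0" "((\<lambda>\<epsilon>. p \<epsilon> x y / \<epsilon> ^ n) \<longlongrightarrow> c) (at_right 0)"
      "((\<lambda>\<epsilon>. path_prob (p \<epsilon>) (y # ys) / \<epsilon> ^ m) \<longlongrightarrow> d) (at_right 0)"
      using IH o by (auto simp: is_Theta_def)
    from tendsto_mult[OF cd(3,4)] cd
    have "is_Theta (\<lambda>\<epsilon>. path_prob (p \<epsilon>) (x # y # ys)) (\<lambda>\<epsilon>. \<epsilon> ^ (n + m))"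
      unfolding is_Theta_def by (intro exI[of _ "c * d"]) (simp add: power_add)
    then show ?thesis using 3 by simp
  qed
qed (auto simp: is_Theta_def path_prob_def steps_def zero_enat_def intro!: exI[of _ 1])

text \<open>Orders multiply along a path and the exponent is unique. The analytic condition in the
  distance thus becomes an equation between costs, and distances are shortest-path lengths for the
  edge costs \<open>r\<close>.\<close>

lemma path_prob_order_iff:
  assumes "has_order p r"
  shows "is_Theta (\<lambda>\<epsilon>. path_prob (p \<epsilon>) \<omega>) (\<lambda>\<epsilon>. \<epsilon> ^ n) \<longleftrightarrow> path_cost r \<omega> = enat n"
  using path_prob_order[OF assms, of \<omega>] is_Theta_nonzero is_Theta_pow_unique
  by (cases "path_cost r \<omega>") auto

lemma dist_states_eq:
  assumes "has_order p r"
  shows "dist_states p g t x z =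
    Inf {enat n | n. \<exists>\<omega>\<in>paths_between g t x z. path_cost r \<omega> = enat n}"
  unfolding dist_states_def path_prob_order_iff[OF assms] ..

lemma dist_states_le:
  assumes "has_order p r" "\<omega> \<in> paths_between g t x z"
  shows "dist_states p g t x z \<le> path_cost r \<omega>"
  unfolding dist_states_eq[OF assms(1)] using assms(2)
  by (cases "path_cost r \<omega>") (auto intro!: Inf_lower)

text \<open>A finite infimum means that the set of costs is nonempty, and \<open>enat\<close> is
  well-ordered, so the infimum is a member.\<close>

lemma dist_states_attained:
  assumes "has_order p r" "dist_states p g t x z = enat n"
  obtains \<omega> where "\<omega> \<in> paths_between g t x z" "path_cost r \<omega> = enat n"
proof -
  let ?A = "{enat n | n. \<exists>\<omega>\<in>paths_between g t x z. path_cost r \<omega> = enat n}"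
  have "?A \<noteq> {}"
    using assms unfolding dist_states_eq[OF assms(1)] by (metis Inf_enat_def enat.distinct(1))
  then have "Inf ?A \<in> ?A"
    using LeastI[of "\<lambda>e. e \<in> ?A"] by (auto simp: Inf_enat_def)
  then show ?thesis
    using assms(2) that unfolding dist_states_eq[OF assms(1)] by auto
qed

text \<open>Prepend \<open>x\<close> to an optimal path from \<open>y\<close>; this is a legal path
  because only the last state may be \<open>t\<close> or \<open>g\<close>.\<close>

lemma dist_states_step:
  assumes "has_order p r" "x \<notin> {t, g}"
  shows "dist_states p g t x z \<le> r x y + dist_states p g t y z"
proof (cases "dist_states p g t y z")
  case (enat n)
  then obtain \<omega> where \<omega>: "\<omega> \<in> paths_between g t y z" "path_cost r \<omega> = enat n"
    using dist_states_attained[OF assms(1)] by blast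
  then obtain ys where ys: "\<omega> = y # ys"
    by (cases \<omega>) (auto simp: paths_between_def)
  have "x # \<omega> \<in> paths_between g t x z"
    using \<omega> ys assms(2) by (simp add: paths_between_Cons)
  from dist_states_le[OF assms(1) this] show ?thesis
    using \<omega> ys enat by simp
qed simp

section \<open>Superharmonic bounds for sums over paths\<close>

text \<open>A Kraft-type inequality: the set of paths stopped at \<open>{g, t}\<close> is prefix-free.\<close>

lemma sum_weight_le_superharmonic:
  fixes w :: "'a list \<Rightarrow> real" and k :: "'a \<Rightarrow> 'a \<Rightarrow> real" and f :: "'a \<Rightarrow> real"
  assumes nonneg: "\<And>x y. x \<in> A - E - {t, g} \<Longrightarrow> 0 \<le> k x y" "\<And>x. 0 \<le> f x"
    and Z: "Z \<subseteq> {t, g}"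
    and stop: "\<And>x F. x \<in> A \<Longrightarrow> x \<in> E \<Longrightarrow> finite F \<Longrightarrow> F \<subseteq> (\<Union>z\<in>Z. paths_between g t x z) \<Longrightarrow> sum w F \<le> f x"
    and single: "\<And>x. x \<in> A \<Longrightarrow> x \<in> Z \<Longrightarrow> w [x] \<le> f x"
    and step: "\<And>x y ys. x \<in> A - E - {t, g} \<Longrightarrow> w (x # y # ys) \<le> k x y * w (y # ys)"
    and outside: "\<And>x y. x \<in> A - E - {t, g} \<Longrightarrow> y \<notin> A \<Longrightarrow> k x y = 0"
    and superharmonic: "\<And>x Y. x \<in> A - E - {t, g} \<Longrightarrow> finite Y \<Longrightarrow> Y \<subseteq> A \<Longrightarrow> (\<Sum>y\<in>Y. k x y * f y) \<le> f x"
    and F: "x \<in> A" "finite F" "F \<subseteq> (\<Union>z\<in>Z. paths_between g t x z)"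
  shows "sum w F \<le> f x"
proof -
  \<comment> \<open>Induction on a bound for the lengths, with the start and the set of paths
    generalised.\<close>
  have "\<forall>\<omega>\<in>F. length \<omega> \<le> n \<Longrightarrow> sum w F \<le> f x"
    if "x \<in> A" "finite F" "F \<subseteq> (\<Union>z\<in>Z. paths_between g t x z)" for n x F
    using that
  proof (induction n arbitrary: x F)
    case 0
    then have "F = {}" by (fastforce simp: paths_between_def)
    then show ?case using nonneg(2) by simp
  next
    case (Suc n)
    consider "x \<in> E" | "x \<in> {t, g}" "x \<notin> E" | "x \<notin> E" "x \<notin> {t, g}" by blast
    then show ?case
    proof cases
      case 1
      with stop Suc show ?thesis by blast
    next
      case 2
      have "\<omega> = [x] \<and> x \<in> Z" if "\<omega> \<in> F" for \<omega>
      proof -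
        from that Suc.prems obtain z where "z \<in> Z" "\<omega> \<in> paths_between g t x z" by blast
        moreover from this obtain ys where "\<omega> = x # ys"
          by (cases \<omega>) (auto simp: paths_between_def)
        ultimately show ?thesis
          using 2 by (auto simp: paths_between_Cons split: if_splits)
      qed
      then have "F = {} \<or> (F = {[x]} \<and> x \<in> Z)" by blast
      with single Suc.prems nonneg(2) show ?thesis by auto
    next
      case 3
      \<comment> \<open>Every path in \<open>F\<close> consists of \<open>x\<close> and a shorter
        path. The shorter paths are grouped by their first state \<open>y\<close>; the induction
        hypothesis bounds each group by \<open>f y\<close>, and superharmonicity at \<open>x\<close>
        collects the groups.\<close>
      define G where "G = tl ` F"
      have F: "\<exists>y ys. \<omega> = x # y # ys \<and> y # ys \<in> (\<Union>z\<in>Z. paths_between g t y z) \<and> length (y # ys) \<le> n"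
        if "\<omega> \<in> F" for \<omega>
      proof -
        from that Suc.prems obtain z where z: "z \<in> Z" "\<omega> \<in> paths_between g t x z" by blast
        then obtain ys where ys: "\<omega> = x # ys"
          by (cases \<omega>) (auto simp: paths_between_def)
        with z 3 Z have "ys \<noteq> []" by (auto simp: paths_between_Cons)
        then obtain y zs where "ys = y # zs" by (cases ys) auto
        with z ys that Suc.prems show ?thesis by (auto simp: paths_between_Cons)
      qed
      have FG: "F = Cons x ` G"
        unfolding G_def image_image using F by force
      have fin: "finite G" unfolding G_def using Suc.prems by simp
      have G: "\<exists>ys. \<omega> = hd \<omega> # ys \<and> \<omega> \<in> (\<Union>z\<in>Z. paths_between g t (hd \<omega>) z) \<and> length \<omega> \<le> n"
        if "\<omega> \<in> G" for \<omega>
        using that F unfolding G_def by fastforce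
      have x: "x \<in> A - E - {t, g}" using 3 Suc.prems by blast
      have "sum w F = (\<Sum>\<omega>\<in>G. w (x # \<omega>))"
        unfolding FG by (subst sum.reindex) auto
      also have "\<dots> \<le> (\<Sum>\<omega>\<in>G. k x (hd \<omega>) * w \<omega>)"
      proof (rule sum_mono)
        fix \<omega> assume "\<omega> \<in> G"
        then obtain ys where "\<omega> = hd \<omega> # ys" using G by blast
        then show "w (x # \<omega>) \<le> k x (hd \<omega>) * w \<omega>"
          using step[OF x, of "hd \<omega>" ys] by simp
      qed
      also have "\<dots> = (\<Sum>y\<in>hd ` G. \<Sum>\<omega>\<in>{\<omega> \<in> G. hd \<omega> = y}. k x (hd \<omega>) * w \<omega>)"
        by (rule sum.image_gen[OF fin])
      also have "\<dots> = (\<Sum>y\<in>hd ` G. k x y * sum w {\<omega> \<in> G. hd \<omega> = y})"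
        by (intro sum.cong) (auto simp: sum_distrib_left)
      also have "\<dots> = (\<Sum>y\<in>hd ` G \<inter> A. k x y * sum w {\<omega> \<in> G. hd \<omega> = y})"
        using fin outside[OF x] by (intro sum.mono_neutral_right) auto
      also have "\<dots> \<le> (\<Sum>y\<in>hd ` G \<inter> A. k x y * f y)"
      proof (intro sum_mono mult_left_mono)
        fix y assume y: "y \<in> hd ` G \<inter> A"
        show "0 \<le> k x y" using nonneg x by blast
        have "{\<omega> \<in> G. hd \<omega> = y} \<subseteq> (\<Union>z\<in>Z. paths_between g t y z)" using G by blast
        then show "sum w {\<omega> \<in> G. hd \<omega> = y} \<le> f y"
          using y fin G by (intro Suc.IH) auto
      qed
      also have "\<dots> \<le> f x"
        using superharmonic[OF x, of "hd ` G \<inter> A"] fin by simp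
      finally show ?thesis .
    qed
  qed
  from this[OF F, of "Max (length ` F)"] F(2) show ?thesis by simp
qed

section \<open>Powers with extended exponents and bounds for stopped weights\<close>

definition epow :: "real \<Rightarrow> enat \<Rightarrow> real" where
  "epow \<delta> e = (case e of enat n \<Rightarrow> \<delta> ^ n | \<infinity> \<Rightarrow> 0)"

lemma epow_simps [simp]: "epow \<delta> (enat n) = \<delta> ^ n" "epow \<delta> \<infinity> = 0" "epow \<delta> 0 = 1"
  by (simp_all add: epow_def zero_enat_def)

lemma epow_add: "epow \<delta> (a + b) = epow \<delta> a * epow \<delta> b"
  by (cases a; cases b) (auto simp: power_add)

lemma epow_mult: "epow (\<delta> * \<eta>) e = epow \<delta> e * epow \<eta> e"
  by (cases e) (auto simp: power_mult_distrib)

lemma epow_nonneg: "0 \<le> \<delta> \<Longrightarrow> 0 \<le> epow \<delta> e"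
  by (cases e) auto

lemma epow_mono: "0 \<le> \<delta> \<Longrightarrow> \<delta> \<le> 1 \<Longrightarrow> e \<le> e' \<Longrightarrow> epow \<delta> e' \<le> epow \<delta> e"
  by (cases e; cases e') (auto intro: power_decreasing)

lemma stopped_weight_nonneg:
  assumes "\<omega> \<in> paths_between g t x z"
    and "\<And>x y. x \<notin> E \<Longrightarrow> x \<notin> {t, g} \<Longrightarrow> 0 \<le> k x y" and "\<And>\<omega>. 0 \<le> h \<omega>"
  shows "0 \<le> stopped_weight E k h \<omega>"
  using assms(1) by (induction rule: paths_between_induct) (auto simp: assms)

text \<open>A path that avoids \<open>E\<close> before its end is weighed step by step, each step by
  at least \<open>\<delta>\<close> to its cost, and \<open>h\<close> sees only the one-state path
  \<open>[g]\<close>.\<close>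

lemma stopped_weight_const:
  assumes "\<omega> \<in> paths_between g t x g" "set (butlast \<omega>) \<inter> E = {}"
    and "\<And>x y. x \<notin> E \<Longrightarrow> x \<notin> {t, g} \<Longrightarrow> epow \<delta> (r x y) \<le> k x y" "0 \<le> \<delta>" "0 \<le> h [g]"
  shows "epow \<delta> (stopped_cost E r \<omega>) * h [g] \<le> stopped_weight E k h \<omega>"
  using assms(1,2)
proof (induction rule: paths_between_induct)
  case (step x y ys)
  have "epow \<delta> (r x y) * (epow \<delta> (stopped_cost E r (y # ys)) * h [g])
      \<le> k x y * stopped_weight E k h (y # ys)"
    using step assms by (intro mult_mono mult_nonneg_nonneg epow_nonneg) (auto intro: order_trans[OF epow_nonneg])
  with step show ?case by (simp add: epow_add mult.assoc)
qed simp

text \<open>For a fixed path the weight is a finite product, so the limits of the steps multiply and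
  the costs add up to \<open>n\<close>.\<close>

lemma stopped_weight_tendsto:
  fixes k :: "real \<Rightarrow> 'a \<Rightarrow> 'a \<Rightarrow> real"
  assumes "\<omega> \<in> paths_between g t x g" "set (butlast \<omega>) \<inter> E = {}" "stopped_cost E r \<omega> = enat n"
    and "\<And>x y n. x \<notin> E \<Longrightarrow> x \<notin> {t, g} \<Longrightarrow> r x y = enat n \<Longrightarrow>
      ((\<lambda>\<epsilon>. k \<epsilon> x y / \<epsilon> ^ n) \<longlongrightarrow> c x y) (at_right 0)"
    and "((\<lambda>\<epsilon>. h \<epsilon> [g]) \<longlongrightarrow> b) (at_right 0)"
  shows "((\<lambda>\<epsilon>. stopped_weight E (k \<epsilon>) (h \<epsilon>) \<omega> / \<epsilon> ^ n) \<longlongrightarrow> stopped_weight E c (\<lambda>_. b) \<omega>) (at_right 0)"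
  using assms(1-3)
proof (induction arbitrary: n rule: paths_between_induct)
  case single
  then show ?case using assms by (simp add: zero_enat_def)
next
  case (step x y ys)
  then obtain a m where am: "r x y = enat a" "stopped_cost E r (y # ys) = enat m" "n = a + m"
    by (cases "r x y"; cases "stopped_cost E r (y # ys)") auto
  have "((\<lambda>\<epsilon>. k \<epsilon> x y / \<epsilon> ^ a * (stopped_weight E (k \<epsilon>) (h \<epsilon>) (y # ys) / \<epsilon> ^ m)) \<longlongrightarrow>
      c x y * stopped_weight E c (\<lambda>_. b) (y # ys)) (at_right 0)"
    using step am by (intro tendsto_mult assms(4)) auto
  then show ?case using step am by (simp add: power_add)
qed

section \<open>The chain inside \<open>\<Lambda>\<close> and the paths of minimal cost\<close>

context rare_event_chain
begin

abbreviation "\<Lambda> \<equiv> Lambda p s g t"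
abbreviation "\<Gamma> \<equiv> Gamma_set p s g t"
text \<open>\<open>exit_index\<close> is the first visit to this set. The taboo state may lie in
  \<open>\<Lambda>\<close> and then need not be an exit; paths in \<open>Phi s g t\<close> avoid it
  before their last state.\<close>

abbreviation "exits \<equiv> {x. x \<notin> \<Lambda> \<or> x = g}"
abbreviation "cost_dist \<equiv> dist_states p g t"

lemma has_order_p: "has_order p r"
  unfolding has_order_def
proof (intro allI)
  fix x z
  show "case r x z of enat n \<Rightarrow> is_Theta (\<lambda>\<epsilon>. p \<epsilon> x z) (\<lambda>\<epsilon>. \<epsilon> ^ n)
     | \<infinity> \<Rightarrow> \<forall>\<^sub>F \<epsilon> in at_right 0. p \<epsilon> x z = 0"
    using p_order[of x z] eps0_pos
    by (cases "r x z") (auto simp: eventually_at_right_field)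
qed

lemma eventually_eps: "\<forall>\<^sub>F \<epsilon> in at_right 0. \<epsilon> \<in> {0<..<\<epsilon>0}"
  using eps0_pos by (auto simp: eventually_at_right_field)

lemma p_pos_iff: "\<epsilon> \<in> {0<..<\<epsilon>0} \<Longrightarrow> 0 < p \<epsilon> x y \<longleftrightarrow> r x y \<noteq> \<infinity>"
  using p_order[of x y] by (cases "r x y") auto

lemma p_eq_0_iff: "\<epsilon> \<in> {0<..<\<epsilon>0} \<Longrightarrow> p \<epsilon> x y = 0 \<longleftrightarrow> r x y = \<infinity>"
  using p_pos_iff[of \<epsilon> x y] p_nonneg[of \<epsilon> x y] by auto

text \<open>Whether a step is possible does not depend on \<open>\<epsilon>\<close>, so a successor
  outside \<open>\<Lambda>\<close> satisfies the definition of \<open>\<Gamma>\<close>. Up to and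
  including the exit, a path of possible steps from \<open>\<Lambda>\<close> therefore stays in a
  finite set.\<close>

lemma successor_in: "x \<in> \<Lambda> \<Longrightarrow> r x y \<noteq> \<infinity> \<Longrightarrow> y \<in> \<Lambda> \<union> \<Gamma>"
  using eventually_mono[OF eventually_eps, of "\<lambda>\<epsilon>. 0 < p \<epsilon> x y"] p_pos_iff[of _ x y]
  by (auto simp: Gamma_set_def)

lemma sum_p_le_1: "\<epsilon> \<in> {0<..<\<epsilon>0} \<Longrightarrow> finite Y \<Longrightarrow> (\<Sum>y\<in>Y. p \<epsilon> x y) \<le> 1"
  by (rule finite_sum_le_has_sum[OF p_stochastic]) (auto intro: p_nonneg)

text \<open>The constant 1 is superharmonic for a stochastic kernel. The start is arbitrary, so the
  bound applies to what follows the exit from \<open>\<Lambda>\<close>.\<close>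

lemma sum_path_prob_le_1:
  assumes "\<epsilon> \<in> {0<..<\<epsilon>0}" "Z \<subseteq> {t, g}" "finite F" "F \<subseteq> (\<Union>z\<in>Z. paths_between g t x z)"
  shows "sum (path_prob (p \<epsilon>)) F \<le> 1"
proof (rule sum_weight_le_superharmonic[where A = UNIV and E = "{}" and f = "\<lambda>_. 1" and k = "p \<epsilon>"])
  show "F \<subseteq> (\<Union>z\<in>Z. paths_between g t x z)" by (rule assms)
qed (use assms p_nonneg sum_p_le_1 in auto)

lemma path_prob_nonneg: "\<epsilon> \<in> {0<..<\<epsilon>0} \<Longrightarrow> 0 \<le> path_prob (p \<epsilon>) \<omega>"
  unfolding path_prob_def by (intro prod_nonneg ballI p_nonneg)

definition goal_dist :: nat where "goal_dist = the_enat (cost_dist s g)"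

lemma dist_goal: "cost_dist s g = enat goal_dist"
  using goal_reachable by (auto simp: goal_dist_def)

lemma s_in: "s \<in> \<Lambda>"
proof -
  have "cost_dist s s \<le> path_cost r [s]"
    by (rule dist_states_le[OF has_order_p]) (simp add: paths_between_Cons)
  then show ?thesis by (simp add: Lambda_def)
qed

text \<open>Cut at the first exit state \<open>z\<close>, the path still costs at least the distance
  from \<open>s\<close> to \<open>z\<close>. If \<open>z \<noteq> g\<close>, then \<open>z\<close>
  lies outside \<open>\<Lambda>\<close> and is strictly farther than \<open>g\<close>. Hence the
  minimal cost is possible only for a path that stays in \<open>\<Lambda>\<close> until it reaches
  \<open>g\<close>.\<close>

lemma stopped_cost_goal_path:
  assumes "\<omega> \<in> paths_between g t s g"
  shows "enat goal_dist \<le> stopped_cost exits r \<omega>"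
    and "stopped_cost exits r \<omega> = enat goal_dist \<Longrightarrow> set (butlast \<omega>) \<inter> exits = {}"
proof -
  obtain z \<omega>' where z: "z \<in> exits" "\<omega>' \<in> paths_between g t s z"
    "path_cost r \<omega>' = stopped_cost exits r \<omega>" "z = g \<longrightarrow> set (butlast \<omega>) \<inter> exits = {}"
    using stopped_cost_path[OF assms, of exits r] by auto
  have le: "cost_dist s z \<le> stopped_cost exits r \<omega>"
    using dist_states_le[OF has_order_p z(2)] z(3) by simp
  have gt: "enat goal_dist < cost_dist s z" if "z \<noteq> g"
    using that z(1) dist_goal by (auto simp: Lambda_def)
  from le gt dist_goal show "enat goal_dist \<le> stopped_cost exits r \<omega>" by (cases "z = g") auto
  show "set (butlast \<omega>) \<inter> exits = {}" if "stopped_cost exits r \<omega> = enat goal_dist"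
    using le gt that z(4) by (cases "z = g") auto
qed

text \<open>The paths that can contribute at the leading order
  \<open>\<epsilon> ^ goal_dist\<close>. They do not leave \<open>\<Lambda>\<close> before
  \<open>g\<close>, so for them the stopped cost is the full cost.\<close>

definition core_paths :: "'a list set" where
  "core_paths = {\<omega> \<in> Phi s g t. stopped_cost exits r \<omega> = enat goal_dist}"

lemma core_paths_nonempty: "core_paths \<noteq> {}"
proof -
  obtain \<omega> where \<omega>: "\<omega> \<in> paths_between g t s g" "path_cost r \<omega> = enat goal_dist"
    using dist_states_attained[OF has_order_p dist_goal] by blast
  have "stopped_cost exits r \<omega> \<le> path_cost r \<omega>" by (rule stopped_cost_le) simp
  with \<omega> stopped_cost_goal_path(1)[OF \<omega>(1)] have "\<omega> \<in> core_paths"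
    by (simp add: core_paths_def Phi_def)
  then show ?thesis by blast
qed

section \<open>Cost-free steps and a superharmonic function\<close>

definition zero_edges :: "('a \<times> 'a) set" where
  "zero_edges = {(x, y). x \<in> \<Lambda> - {t, g} \<and> y \<in> \<Lambda> - {t, g} \<and> r x y = 0}"

text \<open>A cycle of cost-free edges is a path of order \<open>\<epsilon> ^ 0\<close> back to its
  start, so by \<open>no_hp_cycle\<close> it sits at \<open>g\<close> or \<open>t\<close>. Those two
  states, whose self-loops are cost-free, are not endpoints of \<open>zero_edges\<close>.\<close>

lemma zero_edges_acyclic: "(x, x) \<notin> zero_edges\<^sup>+"
proof
  assume cyc: "(x, x) \<in> zero_edges\<^sup>+"
  have "\<exists>ys. ys \<noteq> [] \<and> last ys = y \<and> path_cost r (x # ys) = 0" if "(x, y) \<in> zero_edges\<^sup>+" for x y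
    using that
  proof (induction rule: converse_trancl_induct)
    case (base z)
    then show ?case by (intro exI[of _ "[y]"]) (auto simp: zero_edges_def)
  next
    case (step u z)
    then obtain ys where "ys \<noteq> [] \<and> last ys = y \<and> path_cost r (z # ys) = 0" by blast
    with step show ?case by (intro exI[of _ "z # ys"]) (auto simp: zero_edges_def)
  qed
  from this[OF cyc] obtain ys where ys: "ys \<noteq> []" "last ys = x" "path_cost r (x # ys) = 0" by blast
  then have "is_Theta (\<lambda>\<epsilon>. path_prob (p \<epsilon>) (x # ys)) (\<lambda>\<epsilon>. \<epsilon> ^ 0)"
    by (subst path_prob_order_iff[OF has_order_p]) (simp add: zero_enat_def)
  with no_hp_cycle[of "x # ys"] ys have "x \<in> {t, g}"
    by (auto simp: steps_def Suc_le_eq)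
  moreover have "x \<notin> {t, g}"
    using tranclD[OF cyc] by (auto simp: zero_edges_def)
  ultimately show False by blast
qed

text \<open>The rank of \<open>x\<close> is the number of states that can be reached from \<open>x\<close> at no cost.  Cost-free
  steps lower the rank, and all other steps carry a factor \<open>\<delta>\<close> that absorbs \<open>M ^ (N + 1)\<close>.\<close>

lemma exists_potential:
  assumes "1 \<le> D"
  obtains \<delta> f where "0 < \<delta>" "\<delta> \<le> 1" "\<And>x. 1 \<le> f x"
    "\<And>x Y. x \<in> \<Lambda> - {t, g} \<Longrightarrow> finite Y \<Longrightarrow> Y \<subseteq> \<Lambda> \<union> \<Gamma> \<Longrightarrow> (\<Sum>y\<in>Y. D * epow \<delta> (r x y) * f y) \<le> f x"
proof -
  define N where "N = card (\<Lambda> \<union> \<Gamma>)"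
  \<comment> \<open>A sum over \<open>Y\<close> has at most \<open>N\<close> terms, each with a
    factor \<open>D\<close>. Single terms are bounded by \<open>M ^ rank x\<close>, and the one
    extra power of \<open>M\<close> in \<open>f x\<close> pays for the sum.\<close>
  define M where "M = D * real N"
  define rank where "rank x = card {y. (x, y) \<in> zero_edges\<^sup>+}" for x
  define f where "f x = (if x \<in> \<Lambda> - {t, g} then M ^ (rank x + 1) else 1)" for x
  define \<delta> where "\<delta> = 1 / M ^ (N + 1)"
  have fin: "finite (\<Lambda> \<union> \<Gamma>)" using finite_Lambda finite_Gamma by blast
  have "N \<ge> 1" unfolding N_def using s_in fin by (auto simp: Suc_le_eq card_gt_0_iff)
  then have M: "M \<ge> 1" unfolding M_def using assms mult_mono[of 1 D 1 "real N"] by simp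
  have sub: "{y. (x, y) \<in> zero_edges\<^sup>+} \<subseteq> \<Lambda> \<union> \<Gamma>" for x
    by (auto simp: zero_edges_def dest: tranclD2)
  have rank_le: "rank x \<le> N" for x
    unfolding rank_def N_def by (intro card_mono fin sub)
  have rank_less: "rank y < rank x" if "(x, y) \<in> zero_edges" for x y
    unfolding rank_def
  proof (rule psubset_card_mono)
    show "finite {y. (x, y) \<in> zero_edges\<^sup>+}" by (rule finite_subset[OF sub fin])
    \<comment> \<open>Strict, because \<open>y\<close> is reachable from \<open>x\<close> but, by
      acyclicity, not from itself.\<close>
    show "{z. (y, z) \<in> zero_edges\<^sup>+} \<subset> {z. (x, z) \<in> zero_edges\<^sup>+}"
      using that zero_edges_acyclic[of y] by (auto intro: trancl_into_trancl2)
  qed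
  have "1 \<le> M ^ (N + 1)" using M by (rule one_le_power)
  then have \<delta>: "0 < \<delta>" "\<delta> \<le> 1" unfolding \<delta>_def by (auto simp del: power_Suc)
  have f1: "1 \<le> f x" for x using M by (auto simp: f_def intro: one_le_power simp del: power_Suc)
  have fM: "f x \<le> M ^ (N + 1)" for x
    using M rank_le[of x] by (auto simp: f_def intro!: power_increasing one_le_power simp del: power_Suc)
  have "(\<Sum>y\<in>Y. D * epow \<delta> (r x y) * f y) \<le> f x"
    if x: "x \<in> \<Lambda> - {t, g}" and Y: "finite Y" "Y \<subseteq> \<Lambda> \<union> \<Gamma>" for x Y
  proof -
    have "epow \<delta> (r x y) * f y \<le> M ^ rank x" for y
    proof (cases "r x y")
      case (enat n)
      show ?thesis
      proof (cases "n = 0")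
        case True
        have "f y \<le> M ^ rank x"
        proof (cases "y \<in> \<Lambda> - {t, g}")
          case y: True
          then have "(x, y) \<in> zero_edges" using x enat True by (simp add: zero_edges_def zero_enat_def)
          then have "rank y + 1 \<le> rank x" using rank_less by fastforce
          then have "M ^ (rank y + 1) \<le> M ^ rank x" using M by (intro power_increasing)
          then show ?thesis using y by (simp add: f_def)
        qed (use M in \<open>auto simp: f_def\<close>)
        then show ?thesis using enat True by simp
      next
        case False
        then have "\<delta> ^ n \<le> \<delta>" using \<delta> power_decreasing[of 1 n \<delta>] by simp
        then have "\<delta> ^ n * f y \<le> \<delta> * M ^ (N + 1)"
          using \<delta> fM[of y] f1[of y] by (intro mult_mono) auto
        also have "\<dots> = 1" using M by (simp add: \<delta>_def)
        also have "1 \<le> M ^ rank x" using M by simp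
        finally show ?thesis using enat by simp
      qed
    qed (use M in simp)
    then have "(\<Sum>y\<in>Y. D * (epow \<delta> (r x y) * f y)) \<le> (\<Sum>y\<in>Y. D * M ^ rank x)"
      using assms by (intro sum_mono mult_left_mono) auto
    also have "\<dots> = real (card Y) * (D * M ^ rank x)" by simp
    also have "\<dots> \<le> real N * (D * M ^ rank x)"
      unfolding N_def using Y card_mono[OF fin Y(2)] assms M by (intro mult_right_mono) auto
    also have "\<dots> = f x" using x by (simp add: f_def M_def)
    finally show ?thesis by (simp add: mult.assoc)
  qed
  with \<delta> f1 show ?thesis using that by blast
qed

text \<open>For cost weights \<open>\<delta> ^ r x y\<close> every core path has weight at least \<open>\<delta> ^ goal_dist\<close>, while the
  total weight is at most \<open>f s\<close>.\<close>

lemma finite_core_paths: "finite core_paths"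
proof -
  \<comment> \<open>Any admissible \<open>\<epsilon>\<close> will do: it enters only through the
    weight after the exit.\<close>
  obtain \<epsilon> where \<epsilon>: "\<epsilon> \<in> {0<..<\<epsilon>0}" using eps0_pos dense by (auto simp: Bex_def)
  obtain \<delta> f where \<delta>: "0 < \<delta>" "\<delta> \<le> 1" and f: "\<And>x. 1 \<le> f x"
    "\<And>x Y. x \<in> \<Lambda> - {t, g} \<Longrightarrow> finite Y \<Longrightarrow> Y \<subseteq> \<Lambda> \<union> \<Gamma> \<Longrightarrow> (\<Sum>y\<in>Y. 1 * epow \<delta> (r x y) * f y) \<le> f x"
    using exists_potential[of 1] by auto
  let ?w = "stopped_weight exits (\<lambda>x y. epow \<delta> (r x y)) (path_prob (p \<epsilon>))"
  have f0: "0 \<le> f x" for x using f(1)[of x] by simp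
  have "card F \<le> nat \<lfloor>f s / \<delta> ^ goal_dist\<rfloor>" if F: "F \<subseteq> core_paths" "finite F" for F
  proof -
    have "real (card F) * \<delta> ^ goal_dist = (\<Sum>\<omega>\<in>F. \<delta> ^ goal_dist)" by simp
    also have "\<dots> \<le> sum ?w F"
    proof (rule sum_mono)
      fix \<omega> assume "\<omega> \<in> F"
      then have \<omega>: "\<omega> \<in> paths_between g t s g" "stopped_cost exits r \<omega> = enat goal_dist"
        using F by (auto simp: core_paths_def Phi_def)
      have "epow \<delta> (stopped_cost exits r \<omega>) * path_prob (p \<epsilon>) [g] \<le> ?w \<omega>"
        by (rule stopped_weight_const[OF \<omega>(1) stopped_cost_goal_path(2)[OF \<omega>]]) (use \<delta> in auto)
      with \<omega> show "\<delta> ^ goal_dist \<le> ?w \<omega>" by simp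
    qed
    also have "\<dots> \<le> f s"
    proof (rule sum_weight_le_superharmonic[where A = "\<Lambda> \<union> \<Gamma>" and Z = "{g}" and E = exits and t = t and g = g
          and k = "\<lambda>x y. epow \<delta> (r x y)"])
      fix x F assume "x \<in> exits" "finite F" "F \<subseteq> (\<Union>z\<in>{g}. paths_between g t x z)"
      moreover from this have "sum ?w F = sum (path_prob (p \<epsilon>)) F"
        by (intro sum.cong refl) (auto simp: paths_between_def neq_Nil_conv)
      ultimately have "sum ?w F \<le> 1"
        using sum_path_prob_le_1[OF \<epsilon>, of "{g}" F x] by simp
      then show "sum ?w F \<le> f x" using f(1)[of x] by linarith
    next
      fix x y assume "x \<in> \<Lambda> \<union> \<Gamma> - exits - {t, g}" "y \<notin> \<Lambda> \<union> \<Gamma>"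
      then show "epow \<delta> (r x y) = 0" using successor_in[of x y] by (cases "r x y") auto
    next
      fix x Y assume "x \<in> \<Lambda> \<union> \<Gamma> - exits - {t, g}" "finite Y" "Y \<subseteq> \<Lambda> \<union> \<Gamma>"
      then show "(\<Sum>y\<in>Y. epow \<delta> (r x y) * f y) \<le> f x" using f(2)[of x Y] by simp
    qed (use F f f0 \<delta> s_in in \<open>auto simp: core_paths_def Phi_def epow_nonneg\<close>)
    finally have "real (card F) \<le> f s / \<delta> ^ goal_dist" using \<delta> by (simp add: field_simps)
    then show ?thesis by (simp add: le_nat_floor)
  qed
  then show ?thesis using finite_if_finite_subsets_card_bdd by blast
qed

section \<open>Leading-order asymptotics of sums over \<open>\<Phi>\<close>\<close>

text \<open>Trading \<open>\<epsilon>\<close> for the fixed \<open>\<delta>\<close> leaves the factor \<open>(\<epsilon> / \<delta>)\<close> to the cost of the path, which makes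
  the remainder small.\<close>

lemma stopped_weight_le_scaled:
  assumes \<omega>: "\<omega> \<in> paths_between g t x g" and \<epsilon>: "0 \<le> \<epsilon>" "0 < \<delta>" and D: "0 \<le> D"
    and k: "\<And>x y. x \<in> \<Lambda> - {t, g} \<Longrightarrow> 0 \<le> k x y"
    and k_le: "\<And>x y. x \<in> \<Lambda> - {t, g} \<Longrightarrow> k x y \<le> D * epow \<epsilon> (r x y)"
    and h: "\<And>\<omega>. 0 \<le> h \<omega>"
  shows "stopped_weight exits k h \<omega> \<le>
    epow (\<epsilon> / \<delta>) (stopped_cost exits r \<omega>) * stopped_weight exits (\<lambda>x y. D * epow \<delta> (r x y)) h \<omega>"
  using \<omega>
proof (induction rule: paths_between_induct)
  case (step x y ys)
  let ?W = "stopped_weight exits (\<lambda>x y. D * epow \<delta> (r x y)) h (y # ys)"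
  show ?case
  proof (cases "x \<in> exits")
    case False
    then have x: "x \<in> \<Lambda> - {t, g}" using step by auto
    have "k x y * stopped_weight exits k h (y # ys) \<le>
        (D * epow \<epsilon> (r x y)) * (epow (\<epsilon> / \<delta>) (stopped_cost exits r (y # ys)) * ?W)"
      using x D \<epsilon> k k_le h step
      by (intro mult_mono mult_nonneg_nonneg epow_nonneg stopped_weight_nonneg[OF step(2)]) auto
    also have "epow \<epsilon> (r x y) = epow (\<epsilon> / \<delta>) (r x y) * epow \<delta> (r x y)"
      using \<epsilon> by (simp flip: epow_mult)
    finally show ?thesis
      using False by (simp add: epow_add mult_ac)
  qed simp
qed simp

text \<open>Before the exit \<open>C * f\<close> is superharmonic for the kernel
  \<open>D * \<delta> ^ r x y\<close>. At an exit the weights are at most \<open>C\<close> times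
  path probabilities, which sum to at most 1, and \<open>1 \<le> f x\<close>.\<close>

lemma sum_stopped_weight_le:
  assumes \<epsilon>: "\<epsilon> \<in> {0<..<\<epsilon>0}" and \<delta>: "0 < \<delta>" "0 \<le> D" and f: "\<And>x. 1 \<le> f x"
    "\<And>x Y. x \<in> \<Lambda> - {t, g} \<Longrightarrow> finite Y \<Longrightarrow> Y \<subseteq> \<Lambda> \<union> \<Gamma> \<Longrightarrow> (\<Sum>y\<in>Y. D * epow \<delta> (r x y) * f y) \<le> f x"
    and h: "\<And>x \<omega>. x \<in> (\<Lambda> \<union> \<Gamma>) \<inter> exits \<Longrightarrow> \<omega> \<in> paths_between g t x g \<Longrightarrow> h \<omega> \<le> C * path_prob (p \<epsilon>) \<omega>"
    and C: "0 \<le> C" and F: "finite F" "F \<subseteq> paths_between g t s g"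
  shows "sum (stopped_weight exits (\<lambda>x y. D * epow \<delta> (r x y)) h) F \<le> C * f s"
proof (rule sum_weight_le_superharmonic[where A = "\<Lambda> \<union> \<Gamma>" and Z = "{g}" and E = exits and t = t and g = g
      and k = "\<lambda>x y. D * epow \<delta> (r x y)" and f = "\<lambda>x. C * f x"])
  let ?w = "stopped_weight exits (\<lambda>x y. D * epow \<delta> (r x y)) h"
  have stop: "sum ?w F \<le> C * f x"
    if "x \<in> \<Lambda> \<union> \<Gamma>" "x \<in> exits" "finite F" "F \<subseteq> (\<Union>z\<in>{g}. paths_between g t x z)" for x F
  proof -
    have "sum ?w F = sum h F"
      using that by (intro sum.cong refl) (auto simp: paths_between_def neq_Nil_conv)
    also have "\<dots> \<le> (\<Sum>\<omega>\<in>F. C * path_prob (p \<epsilon>) \<omega>)"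
      using h[of x] that by (intro sum_mono) blast
    also have "\<dots> = C * sum (path_prob (p \<epsilon>)) F" by (simp add: sum_distrib_left)
    also have "\<dots> \<le> C * 1"
      using sum_path_prob_le_1[OF \<epsilon>, of "{g}" F x] that C by (intro mult_left_mono) auto
    also have "\<dots> \<le> C * f x" using f(1)[of x] C by (intro mult_left_mono)
    finally show ?thesis .
  qed
  then show "\<And>x F. x \<in> \<Lambda> \<union> \<Gamma> \<Longrightarrow> x \<in> exits \<Longrightarrow> finite F \<Longrightarrow>
    F \<subseteq> (\<Union>z\<in>{g}. paths_between g t x z) \<Longrightarrow> sum ?w F \<le> C * f x" .
  show "?w [x] \<le> C * f x" if "x \<in> \<Lambda> \<union> \<Gamma>" "x \<in> {g}" for x
    using stop[of x "{[x]}"] that by (simp add: paths_between_Cons)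
  show "D * epow \<delta> (r x y) = 0" if "x \<in> \<Lambda> \<union> \<Gamma> - exits - {t, g}" "y \<notin> \<Lambda> \<union> \<Gamma>" for x y
    using successor_in[of x y] that by (cases "r x y") auto
  show "0 \<le> C * f x" for x using C f(1)[of x] by simp
  show "(\<Sum>y\<in>Y. D * epow \<delta> (r x y) * (C * f y)) \<le> C * f x"
    if x: "x \<in> \<Lambda> \<union> \<Gamma> - exits - {t, g}" "finite Y" "Y \<subseteq> \<Lambda> \<union> \<Gamma>" for x Y
  proof -
    have "(\<Sum>y\<in>Y. D * epow \<delta> (r x y) * (C * f y)) = C * (\<Sum>y\<in>Y. D * epow \<delta> (r x y) * f y)"
      by (simp add: sum_distrib_left mult_ac)
    also have "\<dots> \<le> C * f x" using x C f(2)[of x Y] by (intro mult_left_mono) auto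
    finally show ?thesis .
  qed
qed (use F \<delta> s_in in \<open>auto simp: epow_nonneg\<close>)

text \<open>\<open>\<Phi>\<close> is split into the finitely many core paths, whose scaled weights
  converge one by one, and all other paths, whose total weight is
  \<open>O(\<epsilon> ^ (goal_dist + 1))\<close>. Both moments of the estimator are obtained from
  this lemma, with different \<open>k\<close> and \<open>h\<close>.\<close>

lemma stopped_weight_asymptotics:
  fixes k :: "real \<Rightarrow> 'a \<Rightarrow> 'a \<Rightarrow> real" and h :: "real \<Rightarrow> 'a list \<Rightarrow> real"
  assumes k: "\<forall>\<^sub>F \<epsilon> in at_right 0. \<forall>x\<in>\<Lambda> - {t, g}. \<forall>y. 0 \<le> k \<epsilon> x y \<and> (r x y = \<infinity> \<longrightarrow> k \<epsilon> x y = 0)"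
    and klim: "\<forall>x\<in>\<Lambda> - {t, g}. \<forall>y n. r x y = enat n \<longrightarrow>
      ((\<lambda>\<epsilon>. k \<epsilon> x y / \<epsilon> ^ n) \<longlongrightarrow> c x y) (at_right 0)"
    and h: "\<forall>\<^sub>F \<epsilon> in at_right 0. (\<forall>\<omega>. 0 \<le> h \<epsilon> \<omega>) \<and> (\<forall>x\<in>(\<Lambda> \<union> \<Gamma>) \<inter> exits. \<forall>\<omega>\<in>paths_between g t x g.
      h \<epsilon> \<omega> \<le> C * path_prob (p \<epsilon>) \<omega>)"
    and C: "0 \<le> C"
    and hlim: "((\<lambda>\<epsilon>. h \<epsilon> [g]) \<longlongrightarrow> b) (at_right 0)"
  defines "w \<equiv> \<lambda>\<epsilon>. stopped_weight exits (k \<epsilon>) (h \<epsilon>)"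
  shows "\<forall>\<^sub>F \<epsilon> in at_right 0. w \<epsilon> summable_on Phi s g t"
    and "((\<lambda>\<epsilon>. infsum (w \<epsilon>) (Phi s g t) / \<epsilon> ^ goal_dist) \<longlongrightarrow>
      (\<Sum>\<omega>\<in>core_paths. stopped_weight exits c (\<lambda>_. b) \<omega>)) (at_right 0)"
proof -
  note klim = klim[rule_format]
  define B where "B = (\<Lambda> - {t, g}) \<times> (\<Lambda> \<union> \<Gamma>)"
  have B: "finite B" unfolding B_def using finite_Lambda finite_Gamma by blast
  \<comment> \<open>\<open>D\<close> lies strictly above every limit \<open>c x y\<close> on the
    finite set \<open>B\<close>, so
    \<open>k \<epsilon> x y \<le> D * epow \<epsilon> (r x y)\<close> holds there for all small
    \<open>\<epsilon>\<close> at once. Pairs outside \<open>B\<close> are impossible steps, where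
    \<open>k\<close> vanishes.\<close>
  define D where "D = 1 + (\<Sum>(x, y)\<in>B. \<bar>c x y\<bar>)"
  have D: "1 \<le> D" unfolding D_def by (auto intro!: sum_nonneg)
  have "\<forall>\<^sub>F \<epsilon> in at_right 0. \<forall>z\<in>B. k \<epsilon> (fst z) (snd z) \<le> D * epow \<epsilon> (r (fst z) (snd z))"
  proof (rule eventually_ball_finite[OF B], rule ballI)
    fix z assume z: "z \<in> B"
    obtain x y where xy: "z = (x, y)" by (cases z)
    have x: "x \<in> \<Lambda> - {t, g}" using z xy by (auto simp: B_def)
    show "\<forall>\<^sub>F \<epsilon> in at_right 0. k \<epsilon> (fst z) (snd z) \<le> D * epow \<epsilon> (r (fst z) (snd z))"
    proof (cases "r x y")
      case (enat n)
      have "\<bar>c x y\<bar> \<le> (\<Sum>(x, y)\<in>B. \<bar>c x y\<bar>)"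
        using member_le_sum[of z B "\<lambda>(x, y). \<bar>c x y\<bar>"] z B xy by auto
      then have "c x y < D" unfolding D_def by simp
      from order_tendstoD(2)[OF klim[OF x enat] this] eventually_at_right_less[of 0]
      show ?thesis
        by eventually_elim (use enat xy in \<open>simp add: field_simps\<close>)
    next
      case infinity
      from k show ?thesis
        by eventually_elim (use x xy infinity in auto)
    qed
  qed
  then have k_le: "\<forall>\<^sub>F \<epsilon> in at_right 0. \<forall>x\<in>\<Lambda> - {t, g}. \<forall>y. k \<epsilon> x y \<le> D * epow \<epsilon> (r x y)"
    using k
  proof eventually_elim
    case (elim \<epsilon>)
    show ?case
    proof (intro ballI allI)
      fix x y assume x: "x \<in> \<Lambda> - {t, g}"
      show "k \<epsilon> x y \<le> D * epow \<epsilon> (r x y)"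
      proof (cases "r x y = \<infinity>")
        case False
        then have "(x, y) \<in> B" using x successor_in[of x y] by (auto simp: B_def)
        with elim(1) show ?thesis by force
      qed (use elim x in auto)
    qed
  qed
  obtain \<delta> f where \<delta>: "0 < \<delta>" "\<delta> \<le> 1" and f: "\<And>x. 1 \<le> f x"
    "\<And>x Y. x \<in> \<Lambda> - {t, g} \<Longrightarrow> finite Y \<Longrightarrow> Y \<subseteq> \<Lambda> \<union> \<Gamma> \<Longrightarrow> (\<Sum>y\<in>Y. D * epow \<delta> (r x y) * f y) \<le> f x"
    using exists_potential[OF D] by blast
  \<comment> \<open>Then \<open>\<epsilon> / \<delta> \<le> 1\<close>, so a larger cost gives a
    smaller factor.\<close>
  have "\<forall>\<^sub>F \<epsilon> in at_right 0. \<epsilon> < \<delta>"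
    using \<delta> by (auto simp: eventually_at_right_field)
  with k_le k h eventually_eps
  have ev: "\<forall>\<^sub>F \<epsilon> in at_right 0. 0 < \<epsilon> \<and> w \<epsilon> summable_on Phi s g t \<and>
    0 \<le> infsum (w \<epsilon>) (Phi s g t - core_paths) \<and>
    infsum (w \<epsilon>) (Phi s g t - core_paths) \<le> (\<epsilon> / \<delta>) ^ (goal_dist + 1) * (C * f s)"
  proof eventually_elim
    case (elim \<epsilon>)
    have \<epsilon>: "0 \<le> \<epsilon> / \<delta>" "\<epsilon> / \<delta> \<le> 1" "0 \<le> \<epsilon>" using elim \<delta> by auto
    define U where "U = stopped_weight exits (\<lambda>x y. D * epow \<delta> (r x y)) (h \<epsilon>)"
    have U: "0 \<le> U \<omega>" and w0: "0 \<le> w \<epsilon> \<omega>" if "\<omega> \<in> Phi s g t" for \<omega>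
      using that elim \<delta> D unfolding U_def w_def Phi_def
      by (auto intro!: stopped_weight_nonneg mult_nonneg_nonneg epow_nonneg)
    have w_le: "w \<epsilon> \<omega> \<le> (\<epsilon> / \<delta>) ^ n * U \<omega>"
      if "\<omega> \<in> Phi s g t" "enat n \<le> stopped_cost exits r \<omega>" for \<omega> n
    proof -
      have "w \<epsilon> \<omega> \<le> epow (\<epsilon> / \<delta>) (stopped_cost exits r \<omega>) * U \<omega>"
        unfolding w_def U_def using that elim \<delta> D
        by (intro stopped_weight_le_scaled) (auto simp: Phi_def)
      also have "\<dots> \<le> epow (\<epsilon> / \<delta>) (enat n) * U \<omega>"
        using that U \<epsilon> by (intro mult_right_mono epow_mono) auto
      finally show ?thesis by simp
    qed
    have sum_le: "sum (w \<epsilon>) F \<le> (\<epsilon> / \<delta>) ^ n * (C * f s)"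
      if "finite F" "F \<subseteq> Phi s g t" "\<And>\<omega>. \<omega> \<in> F \<Longrightarrow> enat n \<le> stopped_cost exits r \<omega>" for F n
    proof -
      have "sum (w \<epsilon>) F \<le> (\<Sum>\<omega>\<in>F. (\<epsilon> / \<delta>) ^ n * U \<omega>)"
        using that w_le by (intro sum_mono) auto
      also have "\<dots> = (\<epsilon> / \<delta>) ^ n * sum U F" by (simp add: sum_distrib_left)
      also have "\<dots> \<le> (\<epsilon> / \<delta>) ^ n * (C * f s)"
        unfolding U_def using elim that \<delta> D f C \<epsilon>
        by (intro mult_left_mono sum_stopped_weight_le) (auto simp: Phi_def)
      finally show ?thesis .
    qed
    have summable: "w \<epsilon> summable_on Phi s g t"
    proof (rule nonneg_bdd_above_summable_on[OF w0])
      show "bdd_above (sum (w \<epsilon>) ` {F. F \<subseteq> Phi s g t \<and> finite F})"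
        \<comment> \<open>The exponent 0 is allowed for every path, which bounds all finite partial
          sums.\<close>
        using sum_le[of _ 0] by (intro bdd_aboveI[of _ "C * f s"]) (auto simp flip: zero_enat_def)
    qed
    have "infsum (w \<epsilon>) (Phi s g t - core_paths) \<le> (\<epsilon> / \<delta>) ^ (goal_dist + 1) * (C * f s)"
    proof (rule infsum_le_finite_sums)
      show "w \<epsilon> summable_on Phi s g t - core_paths"
        by (rule summable_on_subset[OF summable]) auto
      show "sum (w \<epsilon>) F \<le> (\<epsilon> / \<delta>) ^ (goal_dist + 1) * (C * f s)"
        if "finite F" "F \<subseteq> Phi s g t - core_paths" for F
      proof (rule sum_le)
        \<comment> \<open>Costs are integers, so a path that is not minimal costs at least one more;
          this gains a full factor \<open>\<epsilon>\<close>.\<close>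
        show "enat (goal_dist + 1) \<le> stopped_cost exits r \<omega>" if "\<omega> \<in> F" for \<omega>
        proof -
          have "\<omega> \<in> paths_between g t s g" "stopped_cost exits r \<omega> \<noteq> enat goal_dist"
            using that \<open>F \<subseteq> _\<close> by (auto simp: core_paths_def Phi_def)
          then show ?thesis using stopped_cost_goal_path(1)[of \<omega>]
            by (cases "stopped_cost exits r \<omega>") auto
        qed
      qed (use that in auto)
    qed
    moreover have "0 \<le> infsum (w \<epsilon>) (Phi s g t - core_paths)"
      using w0 by (intro infsum_nonneg) auto
    ultimately show ?case using summable elim by auto
  qed
  then show "\<forall>\<^sub>F \<epsilon> in at_right 0. w \<epsilon> summable_on Phi s g t" by eventually_elim auto
  have core: "((\<lambda>\<epsilon>. \<Sum>\<omega>\<in>core_paths. w \<epsilon> \<omega> / \<epsilon> ^ goal_dist) \<longlongrightarrow>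
      (\<Sum>\<omega>\<in>core_paths. stopped_weight exits c (\<lambda>_. b) \<omega>)) (at_right 0)"
  proof (rule tendsto_sum)
    fix \<omega> assume "\<omega> \<in> core_paths"
    then have \<omega>: "\<omega> \<in> paths_between g t s g" "stopped_cost exits r \<omega> = enat goal_dist"
      by (auto simp: core_paths_def Phi_def)
    show "((\<lambda>\<epsilon>. w \<epsilon> \<omega> / \<epsilon> ^ goal_dist) \<longlongrightarrow> stopped_weight exits c (\<lambda>_. b) \<omega>) (at_right 0)"
      unfolding w_def
    proof (rule stopped_weight_tendsto[OF \<omega>(1) stopped_cost_goal_path(2)[OF \<omega>] \<omega>(2)])
      show "((\<lambda>\<epsilon>. k \<epsilon> x y / \<epsilon> ^ n) \<longlongrightarrow> c x y) (at_right 0)"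
        if "x \<notin> exits" "x \<notin> {t, g}" "r x y = enat n" for x y n
        using that by (intro klim) auto
    qed (rule hlim)
  qed
  have "((\<lambda>\<epsilon>. infsum (w \<epsilon>) (Phi s g t - core_paths) / \<epsilon> ^ goal_dist) \<longlongrightarrow> 0) (at_right 0)"
  \<comment> \<open>Dividing \<open>(\<epsilon> / \<delta>) ^ (goal_dist + 1)\<close> by
    \<open>\<epsilon> ^ goal_dist\<close> leaves one factor \<open>\<epsilon>\<close>.\<close>
  proof (rule tendsto_sandwich[where f = "\<lambda>_. 0" and h = "\<lambda>\<epsilon>. \<epsilon> * (C * f s / \<delta> ^ (goal_dist + 1))"])
    have "((\<lambda>\<epsilon>. \<epsilon> * (C * f s / \<delta> ^ (goal_dist + 1))) \<longlongrightarrow> 0 * (C * f s / \<delta> ^ (goal_dist + 1))) (at_right 0)"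
      by (intro tendsto_intros)
    then show "((\<lambda>\<epsilon>. \<epsilon> * (C * f s / \<delta> ^ (goal_dist + 1))) \<longlongrightarrow> 0) (at_right 0)" by simp
    show "\<forall>\<^sub>F \<epsilon> in at_right 0. infsum (w \<epsilon>) (Phi s g t - core_paths) / \<epsilon> ^ goal_dist
        \<le> \<epsilon> * (C * f s / \<delta> ^ (goal_dist + 1))"
      using ev by eventually_elim (use \<delta> in \<open>auto simp: field_simps power_divide\<close>)
    show "\<forall>\<^sub>F \<epsilon> in at_right 0. 0 \<le> infsum (w \<epsilon>) (Phi s g t - core_paths) / \<epsilon> ^ goal_dist"
      using ev by eventually_elim auto
  qed auto
  with core have "((\<lambda>\<epsilon>. (\<Sum>\<omega>\<in>core_paths. w \<epsilon> \<omega> / \<epsilon> ^ goal_dist) +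
      infsum (w \<epsilon>) (Phi s g t - core_paths) / \<epsilon> ^ goal_dist) \<longlongrightarrow>
      (\<Sum>\<omega>\<in>core_paths. stopped_weight exits c (\<lambda>_. b) \<omega>) + 0) (at_right 0)"
    by (rule tendsto_add)
  moreover have "\<forall>\<^sub>F \<epsilon> in at_right 0. (\<Sum>\<omega>\<in>core_paths. w \<epsilon> \<omega> / \<epsilon> ^ goal_dist) +
      infsum (w \<epsilon>) (Phi s g t - core_paths) / \<epsilon> ^ goal_dist = infsum (w \<epsilon>) (Phi s g t) / \<epsilon> ^ goal_dist"
    using ev
  proof eventually_elim
    case (elim \<epsilon>)
    have "Phi s g t = core_paths \<union> (Phi s g t - core_paths)" by (auto simp: core_paths_def)
    moreover have "w \<epsilon> summable_on (Phi s g t - core_paths)"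
      using elim by (auto intro: summable_on_subset)
    ultimately have "infsum (w \<epsilon>) (Phi s g t) = sum (w \<epsilon>) core_paths + infsum (w \<epsilon>) (Phi s g t - core_paths)"
      using finite_core_paths infsum_Un_disjoint[of "w \<epsilon>" core_paths "Phi s g t - core_paths"] by simp
    then show ?case by (simp add: add_divide_distrib sum_divide_distrib)
  qed
  ultimately show "((\<lambda>\<epsilon>. infsum (w \<epsilon>) (Phi s g t) / \<epsilon> ^ goal_dist) \<longlongrightarrow>
      (\<Sum>\<omega>\<in>core_paths. stopped_weight exits c (\<lambda>_. b) \<omega>)) (at_right 0)"
    using Lim_transform_eventually by force
qed

end

section \<open>The exit index, a recursion for \<open>Q\<close>, and analytic tools\<close>

lemma path_cost_eq_stopped_cost:
  assumes "\<omega> \<in> paths_between g t x z" "set (butlast \<omega>) \<inter> E = {}" "\<And>x y. x \<notin> E \<Longrightarrow> r' x y = r x y"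
  shows "path_cost r' \<omega> = stopped_cost E r \<omega>"
  using assms(1,2) by (induction rule: paths_between_induct) (auto simp: assms(3))

lemma enat_less_exit_index:
  "enat i < exit_index p s g t \<omega> \<longleftrightarrow>
     (\<forall>j\<le>i. j < length \<omega> \<longrightarrow> \<omega> ! j \<in> Lambda p s g t \<and> \<omega> ! j \<noteq> g)"
proof -
  have "exit_index p s g t \<omega> \<le> enat i \<longleftrightarrow>
     (\<exists>j\<le>i. j < length \<omega> \<and> (\<omega> ! j \<notin> Lambda p s g t \<or> \<omega> ! j = g))" (is "?l \<longleftrightarrow> ?r")
  proof
    let ?A = "{enat i | i. i < length \<omega> \<and> (\<omega> ! i \<notin> Lambda p s g t \<or> \<omega> ! i = g)}"
    assume l: ?l
    then have "?A \<noteq> {}" unfolding exit_index_def by (metis Inf_enat_def enat_ord_code(5) infinity_ileE)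
    then have "Inf ?A \<in> ?A" using LeastI[of "\<lambda>e. e \<in> ?A"] by (auto simp: Inf_enat_def)
    with l show ?r unfolding exit_index_def by auto
  next
    assume ?r
    then show ?l unfolding exit_index_def by (auto intro!: Inf_lower2)
  qed
  then show ?thesis by (auto simp flip: not_le)
qed

lemma Q_prob_single: "Q_prob p s g t v \<epsilon> [x] = 1"
  by (simp add: Q_prob_def steps_def)

text \<open>Replaces the global index in the definition by a recursion of the same shape as
  \<open>stopped_weight\<close>. If the first state is an exit, the exit index is 0 and all factors
  come from \<open>p\<close>; otherwise the exit index of the tail is shifted by one.\<close>

lemma Q_prob_Cons:
  "Q_prob p s g t v \<epsilon> (x # y # ys) =
     (if x \<notin> Lambda p s g t \<or> x = g then path_prob (p \<epsilon>) (x # y # ys)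
      else p_bar p s g t \<epsilon> x y * v \<epsilon> y / (\<Sum>\<^sub>\<infinity>z. p_bar p s g t \<epsilon> x z * v \<epsilon> z) *
        Q_prob p s g t v \<epsilon> (y # ys))"
proof (cases "x \<notin> Lambda p s g t \<or> x = g")
  case True
  then have "\<not> enat i < exit_index p s g t (x # y # ys)" for i
    unfolding enat_less_exit_index by (auto dest: spec[of _ 0])
  then show ?thesis using True by (simp add: Q_prob_def path_prob_def)
next
  case False
  have "enat (Suc i) < exit_index p s g t (x # y # ys) \<longleftrightarrow> enat i < exit_index p s g t (y # ys)" for i
  proof -
    have "(\<forall>j\<le>Suc i. R j) \<longleftrightarrow> R 0 \<and> (\<forall>j\<le>i. R (Suc j))" for R
      using All_less_Suc2[of "Suc i" R] by (simp add: less_Suc_eq_le)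
    from this[of "\<lambda>j. j < length (x # y # ys) \<longrightarrow> (x # y # ys) ! j \<in> Lambda p s g t \<and> (x # y # ys) ! j \<noteq> g"]
    show ?thesis unfolding enat_less_exit_index using False by simp
  qed
  moreover have "enat 0 < exit_index p s g t (x # y # ys)"
    unfolding enat_less_exit_index using False by auto
  moreover have "{..<steps (x # y # ys)} = {..<Suc (steps (y # ys))}" by (simp add: steps_def)
  ultimately show ?thesis
    using False unfolding Q_prob_def[of _ _ _ _ _ _ "x # y # ys"] Q_prob_def[of _ _ _ _ _ _ "y # ys"]
    by (simp add: prod.lessThan_Suc_shift del: prod.lessThan_Suc cong: if_cong)
qed

text \<open>A convergent nonnegative sum converges absolutely and so is an integral for the counting
  measure. This links the path sums to the moments under \<open>Q_law\<close>.\<close>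

lemma integral_count_space_nonneg:
  fixes f :: "'b \<Rightarrow> real"
  assumes "(f has_sum S) A" "\<And>x. x \<in> A \<Longrightarrow> 0 \<le> f x"
  shows "integrable (count_space A) f" "integral\<^sup>L (count_space A) f = S"
    and "(\<integral>\<^sup>+x. ennreal (f x) \<partial>count_space A) = ennreal S"
proof -
  have "f summable_on A" using assms by (auto simp: summable_on_def)
  then have "(\<lambda>x. norm (f x)) summable_on A" by (rule summable_on_iff_abs_summable_on_real[THEN iffD1])
  then have "Infinite_Set_Sum.abs_summable_on f A" by (rule abs_summable_equivalent[THEN iffD1])
  then show int: "integrable (count_space A) f" and eq: "integral\<^sup>L (count_space A) f = S"
    using infsetsum_infsum[of f A] infsumI[OF assms(1)]
    unfolding abs_summable_on_def infsetsum_def by simp_all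
  show "(\<integral>\<^sup>+x. ennreal (f x) \<partial>count_space A) = ennreal S"
    using nn_integral_eq_integral[OF int] assms(2) eq by (simp add: AE_count_space)
qed

text \<open>The surplus power tends to \<open>0 ^ (n - m)\<close>, which is 1 if
  \<open>n = m\<close> and 0 otherwise, so a limit exists in either case.\<close>

lemma tendsto_power_weaken:
  fixes f :: "real \<Rightarrow> real"
  assumes "((\<lambda>\<epsilon>. f \<epsilon> / \<epsilon> ^ n) \<longlongrightarrow> c) (at_right 0)" "m \<le> n"
  shows "\<exists>c. ((\<lambda>\<epsilon>. f \<epsilon> / \<epsilon> ^ m) \<longlongrightarrow> c) (at_right 0)"
proof -
  have "((\<lambda>\<epsilon>. f \<epsilon> / \<epsilon> ^ n * \<epsilon> ^ (n - m)) \<longlongrightarrow> c * 0 ^ (n - m)) (at_right 0)"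
    by (intro tendsto_intros assms)
  moreover have "\<forall>\<^sub>F \<epsilon> in at_right 0. f \<epsilon> / \<epsilon> ^ n * \<epsilon> ^ (n - m) = f \<epsilon> / \<epsilon> ^ m"
    using eventually_at_right_less[of 0]
    by eventually_elim (use assms in \<open>simp add: field_simps flip: power_add\<close>)
  ultimately show ?thesis by (blast intro: Lim_transform_eventually)
qed

lemma quotient_tendsto_eventually_0:
  fixes f h :: "real \<Rightarrow> real"
  assumes "\<forall>\<^sub>F \<epsilon> in at_right 0. f \<epsilon> = 0"
  shows "\<exists>c. ((\<lambda>\<epsilon>. f \<epsilon> / h \<epsilon>) \<longlongrightarrow> c) (at_right 0)"
  by (rule exI[of _ 0], rule tendsto_eventually) (use assms in eventually_elim, simp)

section \<open>Distances to the goal in the modified chain and the size of \<open>v\<close>\<close>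

locale importance_sampling = rare_event_chain +
  fixes v :: "real \<Rightarrow> 'a \<Rightarrow> real"
  assumes v_nonneg: "\<And>\<epsilon> x. \<epsilon> \<in> {0<..<\<epsilon>0} \<Longrightarrow> 0 \<le> v \<epsilon> x"
    and v_order: "uniform_Theta_pow (\<lambda>x \<epsilon>. v \<epsilon> x) (\<lambda>x. d_bar p s g t x g)"
begin

abbreviation "goal_cost x \<equiv> d_bar p s g t x g"
abbreviation "P \<epsilon> \<equiv> path_prob (p \<epsilon>)"
abbreviation "Q \<epsilon> \<equiv> Q_prob p s g t v \<epsilon>"

definition r_bar :: "'a \<Rightarrow> 'a \<Rightarrow> enat" where
  "r_bar x z = (if x \<in> \<Gamma> then (if z = g then 0 else \<infinity>) else r x z)"

lemma has_order_p_bar: "has_order (p_bar p s g t) r_bar"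
proof -
  have "is_Theta (\<lambda>_. 1) (\<lambda>\<epsilon>. \<epsilon> ^ 0)" by (auto simp: is_Theta_def intro!: exI[of _ 1])
  then have "case r_bar x z of
      \<infinity> \<Rightarrow> \<forall>\<^sub>F \<epsilon> in at_right 0. p_bar p s g t \<epsilon> x z = 0
    | enat n \<Rightarrow> is_Theta (\<lambda>\<epsilon>. p_bar p s g t \<epsilon> x z) (\<lambda>\<epsilon>. \<epsilon> ^ n)" for x z
    using has_order_p unfolding has_order_def r_bar_def p_bar_def
    by (cases "x \<in> \<Gamma>") (auto simp: zero_enat_def if_distribR cong: enat.case_cong)
  then show ?thesis by (simp add: has_order_def)
qed

lemma g_in: "g \<in> \<Lambda>" by (simp add: Lambda_def)

lemma in_Lambda_not_Gamma: "x \<in> \<Lambda> \<Longrightarrow> x \<notin> \<Gamma>" by (simp add: Gamma_set_def)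

lemma goal_cost_goal: "goal_cost g = 0"
proof -
  have "goal_cost g \<le> path_cost r_bar [g]"
    unfolding d_bar_def by (rule dist_states_le[OF has_order_p_bar]) (simp add: paths_between_Cons)
  then show ?thesis by simp
qed

text \<open>The modified chain jumps from \<open>x\<close> to \<open>g\<close> for free. The state
  \<open>t\<close> is excepted because a path may not continue from it.\<close>

lemma goal_cost_Gamma:
  assumes "x \<in> \<Gamma>" "x \<noteq> t"
  shows "goal_cost x = 0"
proof -
  have "x \<noteq> g" using assms g_in in_Lambda_not_Gamma by blast
  then have "goal_cost x \<le> path_cost r_bar [x, g]"
    unfolding d_bar_def using assms
    by (intro dist_states_le[OF has_order_p_bar]) (simp add: paths_between_Cons)
  then show ?thesis using assms by (simp add: r_bar_def)
qed

text \<open>On \<open>\<Lambda>\<close> the modified chain has the original steps. This inequality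
  ensures that no term \<open>p \<epsilon> x z * v \<epsilon> z\<close> is of larger order than
  \<open>v \<epsilon> x\<close>.\<close>

lemma goal_cost_step:
  assumes "x \<in> \<Lambda> - {t, g}"
  shows "goal_cost x \<le> r x y + goal_cost y"
  using dist_states_step[OF has_order_p_bar, of x t g g y] assms in_Lambda_not_Gamma[of x]
  by (simp add: d_bar_def r_bar_def)

text \<open>A core path does not leave \<open>\<Lambda>\<close> before \<open>g\<close>, so it costs
  the same in the modified chain. Conversely, the modification concerns only steps out of
  \<open>\<Gamma>\<close>, after the exit, so the modified cost of a path to \<open>g\<close> is at
  least its stopped cost.\<close>

lemma goal_cost_start: "goal_cost s = enat goal_dist"
proof (rule antisym)
  obtain \<omega> where "\<omega> \<in> core_paths" using core_paths_nonempty by blast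
  then have \<omega>: "\<omega> \<in> paths_between g t s g" "stopped_cost exits r \<omega> = enat goal_dist"
    by (auto simp: core_paths_def Phi_def)
  have "path_cost r_bar \<omega> = stopped_cost exits r \<omega>"
    by (rule path_cost_eq_stopped_cost[OF \<omega>(1) stopped_cost_goal_path(2)[OF \<omega>]])
      (auto simp: r_bar_def Gamma_set_def)
  then show "goal_cost s \<le> enat goal_dist"
    using dist_states_le[OF has_order_p_bar \<omega>(1)] \<omega> by (simp add: d_bar_def)
next
  show "enat goal_dist \<le> goal_cost s"
  proof (cases "goal_cost s")
    case (enat n)
    then obtain \<omega> where \<omega>: "\<omega> \<in> paths_between g t s g" "path_cost r_bar \<omega> = enat n"
      using dist_states_attained[OF has_order_p_bar enat[unfolded d_bar_def]] by blast
    have "stopped_cost exits r \<omega> \<le> path_cost r_bar \<omega>"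
      by (rule stopped_cost_le) (auto simp: r_bar_def Gamma_set_def)
    with \<omega> stopped_cost_goal_path(1)[OF \<omega>(1)] enat show ?thesis by (metis order_trans)
  qed simp
qed

lemma v_orderE:
  obtains a where "0 < a"
    "\<And>x n. goal_cost x = enat n \<Longrightarrow> \<exists>c>a. ((\<lambda>\<epsilon>. v \<epsilon> x / \<epsilon> ^ n) \<longlongrightarrow> c) (at_right 0)"
    "\<And>x. goal_cost x = \<infinity> \<Longrightarrow> \<forall>\<^sub>F \<epsilon> in at_right 0. v \<epsilon> x = 0"
proof -
  obtain a b :: real where a: "0 < a" and ab: "\<And>x. case goal_cost x of
       enat n \<Rightarrow> (\<exists>c. a < c \<and> c < b \<and> ((\<lambda>\<epsilon>. v \<epsilon> x / \<epsilon> ^ n) \<longlongrightarrow> c) (at_right 0))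
     | \<infinity> \<Rightarrow> (\<forall>\<^sub>F \<epsilon> in at_right 0. v \<epsilon> x = 0)"
    using v_order unfolding uniform_Theta_pow_def by blast
  show ?thesis
  proof (rule that[OF a])
    show "\<exists>c>a. ((\<lambda>\<epsilon>. v \<epsilon> x / \<epsilon> ^ n) \<longlongrightarrow> c) (at_right 0)" if "goal_cost x = enat n" for x n
      using ab[of x] unfolding that by auto
    show "\<forall>\<^sub>F \<epsilon> in at_right 0. v \<epsilon> x = 0" if "goal_cost x = \<infinity>" for x
      using ab[of x] unfolding that by simp
  qed
qed

lemma v_tendsto:
  assumes "goal_cost x = enat n"
  obtains c where "0 < c" "((\<lambda>\<epsilon>. v \<epsilon> x / \<epsilon> ^ n) \<longlongrightarrow> c) (at_right 0)"
  using v_orderE assms by (metis less_trans)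

lemma v_eventually_0:
  assumes "goal_cost x = \<infinity>"
  shows "\<forall>\<^sub>F \<epsilon> in at_right 0. v \<epsilon> x = 0"
  using v_orderE assms by metis

lemma v_eventually_pos:
  assumes "goal_cost x \<noteq> \<infinity>"
  shows "\<forall>\<^sub>F \<epsilon> in at_right 0. 0 < v \<epsilon> x"
proof -
  obtain n where "goal_cost x = enat n" using assms by auto
  then obtain c where "0 < c" "((\<lambda>\<epsilon>. v \<epsilon> x / \<epsilon> ^ n) \<longlongrightarrow> c) (at_right 0)" by (rule v_tendsto)
  from order_tendstoD(1)[OF this(2,1)] eventually_at_right_less[of 0]
  show ?thesis by eventually_elim (simp add: zero_less_divide_iff)
qed

text \<open>These states have distance 0 to the goal in the modified chain, so \<open>v\<close>
  itself has a limit above the uniform lower constant. The bound controls the division by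
  \<open>v\<close> at the exit.\<close>

lemma v_bounded_below:
  obtains \<kappa> where "0 < \<kappa>" "\<forall>\<^sub>F \<epsilon> in at_right 0. \<forall>x\<in>insert g (\<Gamma> - {t}). \<kappa> \<le> v \<epsilon> x"
proof -
  obtain a where ab: "0 < a"
    "\<And>x n. goal_cost x = enat n \<Longrightarrow> \<exists>c>a. ((\<lambda>\<epsilon>. v \<epsilon> x / \<epsilon> ^ n) \<longlongrightarrow> c) (at_right 0)"
    using v_orderE by metis
  have "\<forall>\<^sub>F \<epsilon> in at_right 0. \<forall>x\<in>insert g (\<Gamma> - {t}). a \<le> v \<epsilon> x"
  proof (rule eventually_ball_finite)
    show "\<forall>x\<in>insert g (\<Gamma> - {t}). \<forall>\<^sub>F \<epsilon> in at_right 0. a \<le> v \<epsilon> x"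
    proof
      fix x assume "x \<in> insert g (\<Gamma> - {t})"
      then have "goal_cost x = enat 0"
        using goal_cost_goal goal_cost_Gamma[of x] by (auto simp: zero_enat_def)
      with ab(2)[of x 0] obtain c where "a < c" "((\<lambda>\<epsilon>. v \<epsilon> x) \<longlongrightarrow> c) (at_right 0)" by auto
      from order_tendstoD(1)[OF this(2,1)] show "\<forall>\<^sub>F \<epsilon> in at_right 0. a \<le> v \<epsilon> x"
        by eventually_elim simp
    qed
  qed (use finite_Gamma in simp)
  with ab(1) that show ?thesis by blast
qed

section \<open>Normalising sums and the total mass of \<open>Q\<close>\<close>

definition Pv :: "real \<Rightarrow> 'a \<Rightarrow> real" where
  "Pv \<epsilon> x = (\<Sum>\<^sub>\<infinity>z. p_bar p s g t \<epsilon> x z * v \<epsilon> z)"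

lemma p_bar_in: "x \<in> \<Lambda> \<Longrightarrow> p_bar p s g t \<epsilon> x z = p \<epsilon> x z"
  by (simp add: p_bar_def in_Lambda_not_Gamma)

lemma Pv_eq:
  assumes "\<epsilon> \<in> {0<..<\<epsilon>0}" "x \<in> \<Lambda>"
  shows "Pv \<epsilon> x = (\<Sum>z\<in>\<Lambda> \<union> \<Gamma>. p \<epsilon> x z * v \<epsilon> z)"
proof -
  have "p \<epsilon> x z = 0" if "z \<notin> \<Lambda> \<union> \<Gamma>" for z
    using that successor_in[of x z] assms p_eq_0_iff by blast
  then have "Pv \<epsilon> x = infsum (\<lambda>z. p \<epsilon> x z * v \<epsilon> z) (\<Lambda> \<union> \<Gamma>)"
    unfolding Pv_def p_bar_in[OF assms(2)] by (intro infsum_cong_neutral) auto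
  then show ?thesis using finite_Lambda finite_Gamma by simp
qed

lemma sum_le_Pv:
  assumes "\<epsilon> \<in> {0<..<\<epsilon>0}" "x \<in> \<Lambda>" "finite Y"
  shows "(\<Sum>z\<in>Y. p \<epsilon> x z * v \<epsilon> z) \<le> Pv \<epsilon> x"
proof -
  have 0: "p \<epsilon> x z = 0" if "z \<notin> \<Lambda> \<union> \<Gamma>" for z
    using that successor_in[of x z] assms p_eq_0_iff by blast
  have "(\<Sum>z\<in>Y. p \<epsilon> x z * v \<epsilon> z) = (\<Sum>z\<in>Y \<inter> (\<Lambda> \<union> \<Gamma>). p \<epsilon> x z * v \<epsilon> z)"
    using assms 0 by (intro sum.mono_neutral_right) auto
  also have "\<dots> \<le> (\<Sum>z\<in>\<Lambda> \<union> \<Gamma>. p \<epsilon> x z * v \<epsilon> z)"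
    using assms finite_Lambda finite_Gamma p_nonneg v_nonneg
    by (intro sum_mono2) auto
  finally show ?thesis unfolding Pv_eq[OF assms(1,2)] .
qed

lemma Pv_nonneg: "\<epsilon> \<in> {0<..<\<epsilon>0} \<Longrightarrow> x \<in> \<Lambda> \<Longrightarrow> 0 \<le> Pv \<epsilon> x"
  using sum_le_Pv[of \<epsilon> x "{}"] by simp

lemma le_Pv: "\<epsilon> \<in> {0<..<\<epsilon>0} \<Longrightarrow> x \<in> \<Lambda> \<Longrightarrow> p \<epsilon> x y * v \<epsilon> y \<le> Pv \<epsilon> x"
  using sum_le_Pv[of \<epsilon> x "{y}"] by simp

definition q :: "real \<Rightarrow> 'a \<Rightarrow> 'a \<Rightarrow> real" where
  "q \<epsilon> x y = p \<epsilon> x y * v \<epsilon> y / Pv \<epsilon> x"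

lemma Q_Cons: "Q \<epsilon> (x # y # ys) = (if x \<in> exits then P \<epsilon> (x # y # ys) else q \<epsilon> x y * Q \<epsilon> (y # ys))"
  unfolding Q_prob_Cons q_def Pv_def[symmetric] by (auto simp: p_bar_in)

lemma Q_exits: "x \<in> exits \<Longrightarrow> Q \<epsilon> (x # ys) = P \<epsilon> (x # ys)"
  by (cases ys) (auto simp: Q_Cons Q_prob_single)

lemma Q_nonneg:
  assumes "\<epsilon> \<in> {0<..<\<epsilon>0}"
  shows "\<omega> \<in> paths_between g t x z \<Longrightarrow> 0 \<le> Q \<epsilon> \<omega>"
proof (induction rule: paths_between_induct)
  case (step x y ys)
  show ?case
  proof (cases "x \<in> exits")
    case False
    then have "0 \<le> q \<epsilon> x y" using assms by (simp add: q_def p_nonneg v_nonneg Pv_nonneg)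
    with step False show ?thesis by (simp add: Q_Cons)
  qed (use assms in \<open>simp only: Q_exits path_prob_nonneg\<close>)
qed (simp add: Q_prob_single)

text \<open>Again the constant 1 is superharmonic: before the exit the rows of \<open>q\<close> sum
  to at most 1, also where the denominator vanishes, and from the exit on \<open>Q\<close> agrees
  with \<open>P\<close>.\<close>

lemma sum_Q_le_1:
  assumes \<epsilon>: "\<epsilon> \<in> {0<..<\<epsilon>0}" and F: "finite F" "F \<subseteq> absorbed_paths s g t"
  shows "sum (Q \<epsilon>) F \<le> 1"
proof (rule sum_weight_le_superharmonic[where A = UNIV and Z = "{t, g}" and E = exits and k = "q \<epsilon>"
      and f = "\<lambda>_. 1" and x = s and t = t and g = g])
  fix x F assume F: "x \<in> exits" "finite F" "F \<subseteq> (\<Union>z\<in>{t, g}. paths_between g t x z)"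
  have "sum (Q \<epsilon>) F = sum (P \<epsilon>) F"
  proof (rule sum.cong[OF refl])
    fix \<omega> assume "\<omega> \<in> F"
    with F obtain ys where "\<omega> = x # ys" by (cases \<omega>) (auto simp: paths_between_def)
    with F show "Q \<epsilon> \<omega> = P \<epsilon> \<omega>" by (simp only: Q_exits)
  qed
  with F sum_path_prob_le_1[OF \<epsilon> subset_refl, of F x] show "sum (Q \<epsilon>) F \<le> 1" by simp
next
  fix x and Y :: "'a set" assume x: "x \<in> UNIV - exits - {t, g}" and Y: "finite Y"
  then have "(\<Sum>y\<in>Y. q \<epsilon> x y * 1) = (\<Sum>y\<in>Y. p \<epsilon> x y * v \<epsilon> y) / Pv \<epsilon> x"
    by (simp add: q_def sum_divide_distrib)
  also have "\<dots> \<le> 1"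
    using sum_le_Pv[OF \<epsilon> _ Y, of x] Pv_nonneg[OF \<epsilon>, of x] x by (auto simp: divide_le_eq_1)
  finally show "(\<Sum>y\<in>Y. q \<epsilon> x y * 1) \<le> 1" .
next
  show "0 \<le> q \<epsilon> x y" if "x \<in> UNIV - exits - {t, g}" for x y
    using that \<epsilon> by (simp add: q_def p_nonneg v_nonneg Pv_nonneg)
  show "Q \<epsilon> (x # y # ys) \<le> q \<epsilon> x y * Q \<epsilon> (y # ys)" if "x \<in> UNIV - exits - {t, g}" for x y ys
    using that by (simp add: Q_Cons)
qed (use F in \<open>auto simp: Q_prob_single absorbed_paths_def\<close>)

section \<open>The law of the random path as a density\<close>

definition law_weight :: "real \<Rightarrow> 'a list option \<Rightarrow> real" where
  "law_weight \<epsilon> y = (case y of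
     Some \<omega> \<Rightarrow> if \<omega> \<in> absorbed_paths s g t then Q \<epsilon> \<omega> else 0
   | None \<Rightarrow> 1 - infsum (Q \<epsilon>) (absorbed_paths s g t))"

lemma Q_absorbed:
  assumes "\<epsilon> \<in> {0<..<\<epsilon>0}"
  shows "Q \<epsilon> summable_on absorbed_paths s g t" "infsum (Q \<epsilon>) (absorbed_paths s g t) \<le> 1"
    and "\<omega> \<in> absorbed_paths s g t \<Longrightarrow> 0 \<le> Q \<epsilon> \<omega>"
proof -
  show nn: "0 \<le> Q \<epsilon> \<omega>" if "\<omega> \<in> absorbed_paths s g t" for \<omega>
    using that Q_nonneg[OF assms] by (auto simp: absorbed_paths_def)
  show *: "Q \<epsilon> summable_on absorbed_paths s g t"
    using nn sum_Q_le_1[OF assms] by (intro nonneg_bdd_above_summable_on) (auto intro!: bdd_aboveI[of _ 1])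
  show "infsum (Q \<epsilon>) (absorbed_paths s g t) \<le> 1"
    by (rule infsum_le_finite_sums[OF * sum_Q_le_1[OF assms]])
qed

lemma law_weight_nonneg: "\<epsilon> \<in> {0<..<\<epsilon>0} \<Longrightarrow> 0 \<le> law_weight \<epsilon> y"
  using Q_absorbed[of \<epsilon>] by (auto simp: law_weight_def split: option.split)

lemma Q_law_eq:
  assumes "\<epsilon> \<in> {0<..<\<epsilon>0}"
  shows "Q_law p s g t v \<epsilon> = density (count_space UNIV) (law_weight \<epsilon>)"
proof -
  have "(\<integral>\<^sup>+\<omega>. ennreal (Q \<epsilon> \<omega>) \<partial>count_space (absorbed_paths s g t)) =
      ennreal (infsum (Q \<epsilon>) (absorbed_paths s g t))"
    using integral_count_space_nonneg(3)[OF has_sum_infsum[OF Q_absorbed(1)[OF assms]]] Q_absorbed(3)[OF assms] .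
  moreover have "0 \<le> infsum (Q \<epsilon>) (absorbed_paths s g t)"
    using Q_absorbed(3)[OF assms] by (rule infsum_nonneg)
  ultimately show ?thesis
    unfolding Q_law_def
    by (intro arg_cong[where f = "density (count_space UNIV)"] ext)
       (auto simp: law_weight_def ennreal_minus split: option.split simp flip: ennreal_1)
qed

text \<open>Only absorbed paths and \<open>None\<close> carry mass, and \<open>F\<close> vanishes at
  \<open>None\<close>, so the integral is the sum over absorbed paths.\<close>

lemma Q_law_moment:
  fixes F :: "'a list option \<Rightarrow> real"
  assumes \<epsilon>: "\<epsilon> \<in> {0<..<\<epsilon>0}" and F: "F None = 0" "\<And>y. 0 \<le> F y"
    and S: "((\<lambda>\<omega>. Q \<epsilon> \<omega> * F (Some \<omega>)) has_sum S) (absorbed_paths s g t)"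
  shows "integrable (Q_law p s g t v \<epsilon>) F" "integral\<^sup>L (Q_law p s g t v \<epsilon>) F = S"
proof -
  have "((\<lambda>y. law_weight \<epsilon> y * F y) has_sum S) (Some ` absorbed_paths s g t)"
    unfolding has_sum_reindex[OF inj_on_subset[OF inj_Some subset_UNIV]]
    using S by (rule has_sum_cong[THEN iffD1, rotated]) (simp add: law_weight_def)
  then have *: "((\<lambda>y. law_weight \<epsilon> y * F y) has_sum S) UNIV"
    by (rule has_sum_cong_neutral[THEN iffD1, rotated -1]) (auto simp: law_weight_def F image_iff split: option.split)
  have "0 \<le> law_weight \<epsilon> y * F y" for y
    using F law_weight_nonneg[OF \<epsilon>] by simp
  note int = integral_count_space_nonneg[OF * this]
  show "integrable (Q_law p s g t v \<epsilon>) F" "integral\<^sup>L (Q_law p s g t v \<epsilon>) F = S"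
    unfolding Q_law_eq[OF \<epsilon>] using int
    by (simp_all add: integrable_density integral_density law_weight_nonneg[OF \<epsilon>])
qed

lemma prob_space_Q_law:
  assumes \<epsilon>: "\<epsilon> \<in> {0<..<\<epsilon>0}"
  shows "prob_space (Q_law p s g t v \<epsilon>)"
proof
  let ?m = "infsum (Q \<epsilon>) (absorbed_paths s g t)"
  have "(law_weight \<epsilon> has_sum ?m) (Some ` absorbed_paths s g t)"
    unfolding has_sum_reindex[OF inj_on_subset[OF inj_Some subset_UNIV]]
    using has_sum_infsum[OF Q_absorbed(1)[OF \<epsilon>]]
    by (rule has_sum_cong[THEN iffD1, rotated]) (simp add: law_weight_def)
  then have "(law_weight \<epsilon> has_sum (law_weight \<epsilon> None + ?m)) (insert None (Some ` absorbed_paths s g t))"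
    by (intro has_sum_insert) auto
  then have "(law_weight \<epsilon> has_sum 1) (insert None (Some ` absorbed_paths s g t))"
    by (simp add: law_weight_def)
  then have "(law_weight \<epsilon> has_sum 1) UNIV"
    by (rule has_sum_cong_neutral[THEN iffD1, rotated -1]) (auto simp: law_weight_def image_iff split: option.split)
  from integral_count_space_nonneg(3)[OF this law_weight_nonneg[OF \<epsilon>]]
  show "emeasure (Q_law p s g t v \<epsilon>) (space (Q_law p s g t v \<epsilon>)) = 1"
    unfolding Q_law_eq[OF \<epsilon>] by (simp add: emeasure_density)
qed

section \<open>Positivity of \<open>Q\<close> on paths to the goal\<close>

definition good :: "real \<Rightarrow> real \<Rightarrow> bool" where
  "good \<kappa> \<epsilon> \<longleftrightarrow> 0 < \<kappa> \<and> \<epsilon> \<in> {0<..<\<epsilon>0} \<and> (\<forall>x\<in>insert g (\<Gamma> - {t}). \<kappa> \<le> v \<epsilon> x) \<and>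
     (\<forall>x\<in>\<Lambda> - {t, g}. \<forall>y\<in>\<Lambda> \<union> \<Gamma>. 0 < p \<epsilon> x y \<longrightarrow> 0 < v \<epsilon> y \<longrightarrow> 0 < v \<epsilon> x)"

text \<open>\<open>good\<close> collects what the exact moment identities use at a single
  \<open>\<epsilon>\<close>: \<open>v\<close> is bounded below at the relevant exits, and positivity
  of \<open>v\<close> passes backwards along possible steps. It holds eventually because only
  finitely many states and pairs are involved.\<close>

lemma eventually_good: obtains \<kappa> where "0 < \<kappa>" "\<forall>\<^sub>F \<epsilon> in at_right 0. good \<kappa> \<epsilon>"
proof -
  obtain \<kappa> where \<kappa>: "0 < \<kappa>" "\<forall>\<^sub>F \<epsilon> in at_right 0. \<forall>x\<in>insert g (\<Gamma> - {t}). \<kappa> \<le> v \<epsilon> x"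
    by (rule v_bounded_below)
  have "\<forall>\<^sub>F \<epsilon> in at_right 0. \<forall>x\<in>\<Lambda> - {t, g}. \<forall>y\<in>\<Lambda> \<union> \<Gamma>. 0 < p \<epsilon> x y \<longrightarrow> 0 < v \<epsilon> y \<longrightarrow> 0 < v \<epsilon> x"
  proof (intro eventually_ball_finite ballI)
    fix x y assume x: "x \<in> \<Lambda> - {t, g}"
    \<comment> \<open>By the step inequality, an infinite distance at \<open>x\<close> forces an
      impossible step or an infinite distance at \<open>y\<close>.\<close>
    consider "r x y = \<infinity>" | "goal_cost y = \<infinity>" | "goal_cost x \<noteq> \<infinity>"
      using goal_cost_step[OF x, of y] by (metis enat_ord_simps(5) infinity_ileE plus_eq_infty_iff_enat)
    then show "\<forall>\<^sub>F \<epsilon> in at_right 0. 0 < p \<epsilon> x y \<longrightarrow> 0 < v \<epsilon> y \<longrightarrow> 0 < v \<epsilon> x"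
    proof cases
      case 1
      from eventually_eps show ?thesis
        by eventually_elim (use 1 p_pos_iff in blast)
    next
      case 2
      from v_eventually_0[OF 2] show ?thesis by eventually_elim simp
    next
      case 3
      from v_eventually_pos[OF 3] show ?thesis by eventually_elim simp
    qed
  qed (use finite_Lambda finite_Gamma in auto)
  with \<kappa>(2) eventually_eps have "\<forall>\<^sub>F \<epsilon> in at_right 0. good \<kappa> \<epsilon>"
    by eventually_elim (use \<kappa>(1) in \<open>simp add: good_def\<close>)
  with \<kappa>(1) that show ?thesis by blast
qed

text \<open>Positivity of \<open>v\<close> at the exit passes backwards to the start, so every
  denominator before the exit is positive. Hence \<open>Q\<close> misses no path to the goal that
  has positive probability, which makes the estimator unbiased.\<close>

lemma Q_pos:
  assumes "good \<kappa> \<epsilon>"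
  shows "\<omega> \<in> paths_between g t x g \<Longrightarrow> hd \<omega> \<in> \<Lambda> \<union> \<Gamma> \<Longrightarrow> 0 < P \<epsilon> \<omega> \<Longrightarrow> 0 < v \<epsilon> (hd \<omega>) \<and> 0 < Q \<epsilon> \<omega>"
proof (induction rule: paths_between_induct)
  case single
  then show ?case using assms by (auto simp: good_def Q_prob_single)
next
  case (step x y ys)
  show ?case
  proof (cases "x \<in> exits")
    case True
    then have "x \<in> \<Gamma> - {t}" using step by auto
    then have "\<kappa> \<le> v \<epsilon> x" "0 < \<kappa>" using assms by (auto simp: good_def)
    then show ?thesis using step.prems True by (simp only: Q_exits) simp
  next
    case False
    then have x: "x \<in> \<Lambda> - {t, g}" using step by auto
    have \<epsilon>: "\<epsilon> \<in> {0<..<\<epsilon>0}" using assms by (simp add: good_def)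
    have pos: "0 < p \<epsilon> x y" "0 < P \<epsilon> (y # ys)"
      using step.prems p_nonneg[OF \<epsilon>, of x y] path_prob_nonneg[OF \<epsilon>, of "y # ys"]
      by (auto simp: zero_less_mult_iff)
    then have y: "y \<in> \<Lambda> \<union> \<Gamma>" using successor_in[of x y] x p_pos_iff[OF \<epsilon>] by blast
    with step pos have IH: "0 < v \<epsilon> y" "0 < Q \<epsilon> (y # ys)" by auto
    have "0 < v \<epsilon> x" using assms x y pos IH by (auto simp: good_def)
    moreover have "0 < p \<epsilon> x y * v \<epsilon> y" using pos IH by simp
    moreover have "0 < Pv \<epsilon> x" using le_Pv[OF \<epsilon>, of x y] x \<open>0 < p \<epsilon> x y * v \<epsilon> y\<close> by auto
    ultimately show ?thesis using False IH by (simp add: Q_Cons q_def)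
  qed
qed

section \<open>The second moment as a sum of stopped weights\<close>

definition k2 :: "real \<Rightarrow> 'a \<Rightarrow> 'a \<Rightarrow> real" where
  "k2 \<epsilon> x y = p \<epsilon> x y * Pv \<epsilon> x / v \<epsilon> x"

text \<open>One step contributes \<open>p\<^sup>2 / q\<close> to \<open>P\<^sup>2 / Q\<close>;
  multiplied by \<open>v y / v x\<close> this is \<open>k2\<close>, as long as \<open>p\<close>,
  \<open>v x\<close> and \<open>v y\<close> are nonzero. After the exit \<open>P\<^sup>2 / Q\<close>
  equals \<open>P\<close>, and dividing by \<open>v\<close> gives \<open>h2\<close>.\<close>

definition h2 :: "real \<Rightarrow> 'a list \<Rightarrow> real" where
  "h2 \<epsilon> \<omega> = P \<epsilon> \<omega> / v \<epsilon> (hd \<omega>)"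

text \<open>The factors \<open>v \<epsilon> y\<close> in the likelihood ratio telescope along the path.\<close>

lemma second_moment_weight:
  assumes "good \<kappa> \<epsilon>"
  shows "\<omega> \<in> paths_between g t x g \<Longrightarrow> hd \<omega> \<in> \<Lambda> \<union> \<Gamma> \<Longrightarrow>
    (P \<epsilon> \<omega>)\<^sup>2 / Q \<epsilon> \<omega> = v \<epsilon> (hd \<omega>) * stopped_weight exits (k2 \<epsilon>) (h2 \<epsilon>) \<omega>"
proof (induction rule: paths_between_induct)
  case single
  then show ?case using assms by (auto simp: good_def Q_prob_single h2_def)
next
  case (step x y ys)
  show ?case
  proof (cases "x \<in> exits")
    case True
    then have "x \<in> \<Gamma> - {t}" using step by auto
    then have "\<kappa> \<le> v \<epsilon> x" "0 < \<kappa>" using assms by (auto simp: good_def)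
    then show ?thesis using True
      by (simp only: Q_exits stopped_weight_in) (simp add: h2_def power2_eq_square)
  next
    case False
    then have x: "x \<in> \<Lambda> - {t, g}" using step by auto
    have \<epsilon>: "\<epsilon> \<in> {0<..<\<epsilon>0}" using assms by (simp add: good_def)
    let ?w = "stopped_weight exits (k2 \<epsilon>) (h2 \<epsilon>)"
    show ?thesis
    proof (cases "p \<epsilon> x y = 0")
      case True
      then show ?thesis using False by (simp add: k2_def)
    next
      case p: False
      then have p_pos: "0 < p \<epsilon> x y" using p_nonneg[OF \<epsilon>, of x y] by simp
      then have y: "y \<in> \<Lambda> \<union> \<Gamma>" using successor_in[of x y] x p_pos_iff[OF \<epsilon>] by blast
      with step have IH: "(P \<epsilon> (y # ys))\<^sup>2 / Q \<epsilon> (y # ys) = v \<epsilon> y * ?w (y # ys)" by auto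
      show ?thesis
      proof (cases "v \<epsilon> y = 0")
        case True
        \<comment> \<open>Both sides vanish by \<open>x / 0 = 0\<close>: on the right
          \<open>k2\<close> and \<open>h2\<close> divide by \<open>v \<epsilon> y\<close>, on the
          left \<open>q \<epsilon> x y = 0\<close> makes the denominator 0.\<close>
        then have "?w (y # ys) = 0" by (cases ys) (simp_all add: k2_def h2_def)
        with True False show ?thesis by (simp add: Q_Cons q_def)
      next
        case v: False
        then have v_pos: "0 < v \<epsilon> y" using v_nonneg[OF \<epsilon>, of y] by simp
        then have vx: "0 < v \<epsilon> x" using assms x y p_pos by (auto simp: good_def)
        have "0 < p \<epsilon> x y * v \<epsilon> y" using p_pos v_pos by simp
        then have "0 < Pv \<epsilon> x" using le_Pv[OF \<epsilon>, of x y] x by auto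
        have "(P \<epsilon> (x # y # ys))\<^sup>2 / Q \<epsilon> (x # y # ys) =
            (p \<epsilon> x y)\<^sup>2 / q \<epsilon> x y * ((P \<epsilon> (y # ys))\<^sup>2 / Q \<epsilon> (y # ys))"
          using False by (simp add: Q_Cons power_mult_distrib)
        also have "\<dots> = v \<epsilon> x * (k2 \<epsilon> x y * ?w (y # ys))"
          unfolding IH using p_pos v_pos vx \<open>0 < Pv \<epsilon> x\<close>
          by (simp add: q_def k2_def field_simps power2_eq_square)
        finally show ?thesis using False by simp
      qed
    qed
  qed
qed

text \<open>If the goal distance of \<open>x\<close> is finite, say \<open>m\<close>, then
  \<open>goal_cost_step\<close> makes every term of \<open>Pv \<epsilon> x\<close> converge after
  division by \<open>\<epsilon> ^ m\<close>, while \<open>v \<epsilon> x / \<epsilon> ^ m\<close>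
  has a positive limit. If it is infinite, \<open>v \<epsilon> x\<close> and with it
  \<open>k2\<close> are eventually 0.\<close>

lemma k2_tendsto:
  assumes x: "x \<in> \<Lambda> - {t, g}" and n: "r x y = enat n"
  shows "\<exists>c. ((\<lambda>\<epsilon>. k2 \<epsilon> x y / \<epsilon> ^ n) \<longlongrightarrow> c) (at_right 0)"
proof (cases "goal_cost x")
  case infinity
  from v_eventually_0[OF this] have "\<forall>\<^sub>F \<epsilon> in at_right 0. k2 \<epsilon> x y = 0"
    by eventually_elim (simp add: k2_def)
  then show ?thesis by (rule quotient_tendsto_eventually_0)
next
  case (enat m)
  obtain cv where cv: "0 < cv" "((\<lambda>\<epsilon>. v \<epsilon> x / \<epsilon> ^ m) \<longlongrightarrow> cv) (at_right 0)"
    by (rule v_tendsto[OF enat])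
  have p_lim: "\<exists>c. ((\<lambda>\<epsilon>. p \<epsilon> x z / \<epsilon> ^ a) \<longlongrightarrow> c) (at_right 0)" if "r x z = enat a" for z a
    using p_order[of x z, unfolded that] by (auto simp: is_Theta_def)
  have "\<exists>c. ((\<lambda>\<epsilon>. p \<epsilon> x z * v \<epsilon> z / \<epsilon> ^ m) \<longlongrightarrow> c) (at_right 0)" for z
  proof -
    consider "r x z = \<infinity>" | "goal_cost z = \<infinity>"
      | a b where "r x z = enat a" "goal_cost z = enat b"
      by (metis not_infinity_eq)
    then show ?thesis
    proof cases
      case 1
      from eventually_eps have "\<forall>\<^sub>F \<epsilon> in at_right 0. p \<epsilon> x z * v \<epsilon> z = 0"
        by eventually_elim (simp add: 1 p_eq_0_iff)
      then show ?thesis by (rule quotient_tendsto_eventually_0)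
    next
      case 2
      from v_eventually_0[OF 2] have "\<forall>\<^sub>F \<epsilon> in at_right 0. p \<epsilon> x z * v \<epsilon> z = 0"
        by eventually_elim simp
      then show ?thesis by (rule quotient_tendsto_eventually_0)
    next
      case 3
      obtain c where c: "((\<lambda>\<epsilon>. p \<epsilon> x z / \<epsilon> ^ a) \<longlongrightarrow> c) (at_right 0)" using p_lim[OF 3(1)] by blast
      obtain d where d: "((\<lambda>\<epsilon>. v \<epsilon> z / \<epsilon> ^ b) \<longlongrightarrow> d) (at_right 0)" using v_tendsto[OF 3(2)] by blast
      from tendsto_mult[OF c d]
      have "((\<lambda>\<epsilon>. p \<epsilon> x z * v \<epsilon> z / \<epsilon> ^ (a + b)) \<longlongrightarrow> c * d) (at_right 0)" by (simp add: power_add)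
      moreover have "m \<le> a + b" using goal_cost_step[OF x, of z] 3 enat by simp
      ultimately show ?thesis by (rule tendsto_power_weaken)
    qed
  qed
  then obtain c where c: "\<And>z. ((\<lambda>\<epsilon>. p \<epsilon> x z * v \<epsilon> z / \<epsilon> ^ m) \<longlongrightarrow> c z) (at_right 0)" by metis
  obtain cp where cp: "((\<lambda>\<epsilon>. p \<epsilon> x y / \<epsilon> ^ n) \<longlongrightarrow> cp) (at_right 0)" using p_lim[OF n] by blast
  have lim: "((\<lambda>\<epsilon>. p \<epsilon> x y / \<epsilon> ^ n * (\<Sum>z\<in>\<Lambda> \<union> \<Gamma>. p \<epsilon> x z * v \<epsilon> z / \<epsilon> ^ m) / (v \<epsilon> x / \<epsilon> ^ m)) \<longlongrightarrow>
      cp * (\<Sum>z\<in>\<Lambda> \<union> \<Gamma>. c z) / cv) (at_right 0)"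
    using cv(1) by (intro tendsto_divide tendsto_mult tendsto_sum cp c cv(2)) auto
  have eq: "\<forall>\<^sub>F \<epsilon> in at_right 0. p \<epsilon> x y / \<epsilon> ^ n * (\<Sum>z\<in>\<Lambda> \<union> \<Gamma>. p \<epsilon> x z * v \<epsilon> z / \<epsilon> ^ m) / (v \<epsilon> x / \<epsilon> ^ m) =
      k2 \<epsilon> x y / \<epsilon> ^ n"
    using eventually_eps
  proof eventually_elim
    case (elim \<epsilon>)
    have "Pv \<epsilon> x = (\<Sum>z\<in>\<Lambda> \<union> \<Gamma>. p \<epsilon> x z * v \<epsilon> z)"
      using Pv_eq[OF elim, of x] x by blast
    then have "(\<Sum>z\<in>\<Lambda> \<union> \<Gamma>. p \<epsilon> x z * v \<epsilon> z / \<epsilon> ^ m) = Pv \<epsilon> x / \<epsilon> ^ m"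
      by (simp only: sum_divide_distrib)
    then show ?case by (simp only: k2_def) (use elim in simp)
  qed
  show ?thesis by (rule exI, rule Lim_transform_eventually[OF lim eq])
qed

section \<open>Asymptotics of the two moments and the relative error\<close>

lemma stopped_weight_pos:
  assumes "\<And>x y. 0 < k x y" "\<And>\<omega>. 0 < h \<omega>"
  shows "0 < stopped_weight E k h \<omega>"
  using assms by (induction E k h \<omega> rule: stopped_weight.induct) auto

text \<open>With \<open>k = p\<close> and \<open>h = P\<close> the stopped weight is the path
  probability. The limit is positive because the core paths are nonempty and all limits of single
  steps are positive.\<close>

lemma first_moment_tendsto:
  obtains c where "0 < c" "((\<lambda>\<epsilon>. infsum (P \<epsilon>) (Phi s g t) / \<epsilon> ^ goal_dist) \<longlongrightarrow> c) (at_right 0)"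
    "\<forall>\<^sub>F \<epsilon> in at_right 0. P \<epsilon> summable_on Phi s g t"
proof -
  \<comment> \<open>For impossible steps the default 1 keeps \<open>c\<close> positive
    everywhere.\<close>
  have "\<exists>c>0. \<forall>n. r x y = enat n \<longrightarrow> ((\<lambda>\<epsilon>. p \<epsilon> x y / \<epsilon> ^ n) \<longlongrightarrow> c) (at_right 0)" for x y
    using p_order[of x y] by (cases "r x y") (auto simp: is_Theta_def intro: exI[of _ 1])
  then obtain c where c: "\<And>x y. 0 < c x y"
    "\<And>x y n. r x y = enat n \<Longrightarrow> ((\<lambda>\<epsilon>. p \<epsilon> x y / \<epsilon> ^ n) \<longlongrightarrow> c x y) (at_right 0)" by metis
  have clim: "\<forall>x\<in>\<Lambda> - {t, g}. \<forall>y n. r x y = enat n \<longrightarrow>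
      ((\<lambda>\<epsilon>. p \<epsilon> x y / \<epsilon> ^ n) \<longlongrightarrow> c x y) (at_right 0)"
    using c(2) by blast
  have k: "\<forall>\<^sub>F \<epsilon> in at_right 0. \<forall>x\<in>\<Lambda> - {t, g}. \<forall>y. 0 \<le> p \<epsilon> x y \<and> (r x y = \<infinity> \<longrightarrow> p \<epsilon> x y = 0)"
    using eventually_eps by eventually_elim (use p_nonneg p_eq_0_iff in blast)
  have h: "\<forall>\<^sub>F \<epsilon> in at_right 0. (\<forall>\<omega>. 0 \<le> P \<epsilon> \<omega>) \<and> (\<forall>x\<in>(\<Lambda> \<union> \<Gamma>) \<inter> exits. \<forall>\<omega>\<in>paths_between g t x g.
      P \<epsilon> \<omega> \<le> 1 * P \<epsilon> \<omega>)"
    using eventually_eps by eventually_elim (use path_prob_nonneg in simp)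
  have hlim: "((\<lambda>\<epsilon>. P \<epsilon> [g]) \<longlongrightarrow> 1) (at_right 0)" by simp
  note * = stopped_weight_asymptotics[where k = p and h = P, OF k clim h zero_le_one hlim]
  have "stopped_weight exits (p \<epsilon>) (P \<epsilon>) = P \<epsilon>" for \<epsilon>
    by (rule ext) (rule stopped_weight_path_prob)
  note * = *[unfolded this]
  have "0 < (\<Sum>\<omega>\<in>core_paths. stopped_weight exits c (\<lambda>_. 1) \<omega>)"
    by (rule sum_pos[OF finite_core_paths core_paths_nonempty]) (rule stopped_weight_pos, simp_all add: c(1))
  then show ?thesis by (rule that[OF _ *(2,1)])
qed

text \<open>The second moment is \<open>v \<epsilon> s\<close> times a sum of stopped weights. Each
  factor supplies one \<open>\<epsilon> ^ goal_dist\<close>: the first by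
  \<open>goal_cost_start\<close>, the second by \<open>stopped_weight_asymptotics\<close>.\<close>

lemma second_moment_tendsto:
  obtains c where
    "((\<lambda>\<epsilon>. infsum (\<lambda>\<omega>. (P \<epsilon> \<omega>)\<^sup>2 / Q \<epsilon> \<omega>) (Phi s g t) / (\<epsilon> ^ goal_dist)\<^sup>2) \<longlongrightarrow> c) (at_right 0)"
    "\<forall>\<^sub>F \<epsilon> in at_right 0. (\<lambda>\<omega>. (P \<epsilon> \<omega>)\<^sup>2 / Q \<epsilon> \<omega>) summable_on Phi s g t"
proof -
  obtain \<kappa> where \<kappa>: "0 < \<kappa>" "\<forall>\<^sub>F \<epsilon> in at_right 0. good \<kappa> \<epsilon>" by (rule eventually_good)
  have "\<exists>c. x \<in> \<Lambda> - {t, g} \<longrightarrow> (\<forall>n. r x y = enat n \<longrightarrow> ((\<lambda>\<epsilon>. k2 \<epsilon> x y / \<epsilon> ^ n) \<longlongrightarrow> c) (at_right 0))"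
    for x y
  proof (cases "x \<in> \<Lambda> - {t, g} \<and> r x y \<noteq> \<infinity>")
    case True
    then obtain n where n: "r x y = enat n" by blast
    from True k2_tendsto[of x y n] n obtain c where "((\<lambda>\<epsilon>. k2 \<epsilon> x y / \<epsilon> ^ n) \<longlongrightarrow> c) (at_right 0)" by blast
    then show ?thesis by (intro exI[of _ c]) (simp add: n)
  qed auto
  then obtain c where clim: "\<forall>x\<in>\<Lambda> - {t, g}. \<forall>y n. r x y = enat n \<longrightarrow>
    ((\<lambda>\<epsilon>. k2 \<epsilon> x y / \<epsilon> ^ n) \<longlongrightarrow> c x y) (at_right 0)" by metis
  obtain cg where cg: "0 < cg" "((\<lambda>\<epsilon>. v \<epsilon> g / \<epsilon> ^ 0) \<longlongrightarrow> cg) (at_right 0)"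
    using goal_cost_goal by (auto simp: zero_enat_def elim: v_tendsto)
  obtain cs where cs: "((\<lambda>\<epsilon>. v \<epsilon> s / \<epsilon> ^ goal_dist) \<longlongrightarrow> cs) (at_right 0)"
    using goal_cost_start by (auto elim: v_tendsto)
  let ?w = "\<lambda>\<epsilon>. stopped_weight exits (k2 \<epsilon>) (h2 \<epsilon>)"
  have k: "\<forall>\<^sub>F \<epsilon> in at_right 0. \<forall>x\<in>\<Lambda> - {t, g}. \<forall>y. 0 \<le> k2 \<epsilon> x y \<and> (r x y = \<infinity> \<longrightarrow> k2 \<epsilon> x y = 0)"
    using eventually_eps
    by eventually_elim (auto simp: k2_def p_nonneg v_nonneg Pv_nonneg p_eq_0_iff)
  have h: "\<forall>\<^sub>F \<epsilon> in at_right 0. (\<forall>\<omega>. 0 \<le> h2 \<epsilon> \<omega>) \<and> (\<forall>x\<in>(\<Lambda> \<union> \<Gamma>) \<inter> exits. \<forall>\<omega>\<in>paths_between g t x g.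
      h2 \<epsilon> \<omega> \<le> 1 / \<kappa> * P \<epsilon> \<omega>)"
    using \<kappa>(2)
  proof eventually_elim
    case (elim \<epsilon>)
    then have \<epsilon>: "\<epsilon> \<in> {0<..<\<epsilon>0}" by (simp add: good_def)
    have "h2 \<epsilon> \<omega> \<le> 1 / \<kappa> * P \<epsilon> \<omega>" if x: "x \<in> (\<Lambda> \<union> \<Gamma>) \<inter> exits" "\<omega> \<in> paths_between g t x g" for x \<omega>
    proof -
      obtain ys where ys: "\<omega> = x # ys" using x by (cases \<omega>) (auto simp: paths_between_def)
      \<comment> \<open>A path to \<open>g\<close> is \<open>[g]\<close> or starts outside
        \<open>{t, g}\<close>; in the latter case an exit in
        \<open>\<Lambda> \<union> \<Gamma>\<close> lies in \<open>\<Gamma>\<close>.\<close>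
      then have "x \<in> insert g (\<Gamma> - {t})" using x by (auto simp: paths_between_Cons split: if_splits)
      then have "\<kappa> \<le> v \<epsilon> x" using elim unfolding good_def by blast
      then show ?thesis using \<kappa>(1) path_prob_nonneg[OF \<epsilon>, of \<omega>] ys
        by (simp add: h2_def frac_le)
    qed
    then show ?case using \<epsilon> by (auto simp: h2_def path_prob_nonneg v_nonneg)
  qed
  have hlim: "((\<lambda>\<epsilon>. h2 \<epsilon> [g]) \<longlongrightarrow> 1 / cg) (at_right 0)"
    unfolding h2_def using cg by (auto intro!: tendsto_intros)
  have "0 \<le> 1 / \<kappa>" using \<kappa>(1) by simp
  note * = stopped_weight_asymptotics[where k = k2 and h = h2, OF k clim h this hlim]
  have eq: "(P \<epsilon> \<omega>)\<^sup>2 / Q \<epsilon> \<omega> = v \<epsilon> s * ?w \<epsilon> \<omega>" if "good \<kappa> \<epsilon>" "\<omega> \<in> Phi s g t" for \<epsilon> \<omega>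
    using second_moment_weight[OF that(1), of \<omega> s] that(2) s_in paths_between_hd[of \<omega> g t s g]
    by (simp add: Phi_def)
  have "\<forall>\<^sub>F \<epsilon> in at_right 0. (\<lambda>\<omega>. (P \<epsilon> \<omega>)\<^sup>2 / Q \<epsilon> \<omega>) summable_on Phi s g t"
    using *(1) \<kappa>(2)
  proof eventually_elim
    case (elim \<epsilon>)
    then show ?case by (subst summable_on_cong[OF eq[OF elim(2)]]) (auto intro: summable_on_cmult_right)
  qed
  moreover have "((\<lambda>\<epsilon>. infsum (\<lambda>\<omega>. (P \<epsilon> \<omega>)\<^sup>2 / Q \<epsilon> \<omega>) (Phi s g t) / (\<epsilon> ^ goal_dist)\<^sup>2) \<longlongrightarrow>
      cs * (\<Sum>\<omega>\<in>core_paths. stopped_weight exits c (\<lambda>_. 1 / cg) \<omega>)) (at_right 0)"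
  proof (rule Lim_transform_eventually[OF tendsto_mult[OF cs *(2)]])
    show "\<forall>\<^sub>F \<epsilon> in at_right 0. v \<epsilon> s / \<epsilon> ^ goal_dist * (infsum (?w \<epsilon>) (Phi s g t) / \<epsilon> ^ goal_dist) =
        infsum (\<lambda>\<omega>. (P \<epsilon> \<omega>)\<^sup>2 / Q \<epsilon> \<omega>) (Phi s g t) / (\<epsilon> ^ goal_dist)\<^sup>2"
      using \<kappa>(2)
    proof eventually_elim
      case (elim \<epsilon>)
      have "infsum (\<lambda>\<omega>. (P \<epsilon> \<omega>)\<^sup>2 / Q \<epsilon> \<omega>) (Phi s g t) = v \<epsilon> s * infsum (?w \<epsilon>) (Phi s g t)"
        by (subst infsum_cong[OF eq[OF elim]]) (auto simp: infsum_cmult_right')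
      then show ?case by (simp add: power2_eq_square)
    qed
  qed
  ultimately show ?thesis using that by blast
qed

text \<open>On \<open>\<Phi>\<close> the product \<open>Q * (P / Q)\<close> is \<open>P\<close> also
  where \<open>Q = 0\<close>, since there \<open>P = 0\<close> by \<open>Q_pos\<close>. The identity
  \<open>Q * (P / Q)\<^sup>2 = P\<^sup>2 / Q\<close> holds at \<open>Q = 0\<close> because both
  sides are 0.\<close>

lemma estimator_moments:
  assumes good: "good \<kappa> \<epsilon>" and sum1: "P \<epsilon> summable_on Phi s g t"
    and sum2: "(\<lambda>\<omega>. (P \<epsilon> \<omega>)\<^sup>2 / Q \<epsilon> \<omega>) summable_on Phi s g t"
  defines "M \<equiv> Q_law p s g t v \<epsilon>" and "X \<equiv> IS_estimator p s g t v \<epsilon>"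
  shows "integrable M X" "integral\<^sup>L M X = infsum (P \<epsilon>) (Phi s g t)"
    "integrable M (\<lambda>y. (X y)\<^sup>2)"
    "integral\<^sup>L M (\<lambda>y. (X y)\<^sup>2) = infsum (\<lambda>\<omega>. (P \<epsilon> \<omega>)\<^sup>2 / Q \<epsilon> \<omega>) (Phi s g t)"
proof -
  have \<epsilon>: "\<epsilon> \<in> {0<..<\<epsilon>0}" using good by (simp add: good_def)
  have sub: "Phi s g t \<subseteq> absorbed_paths s g t" by (auto simp: Phi_def absorbed_paths_def)
  have Q0: "P \<epsilon> \<omega> = 0" if "\<omega> \<in> Phi s g t" "Q \<epsilon> \<omega> = 0" for \<omega>
    using Q_pos[OF good, of \<omega> s] that s_in paths_between_hd[of \<omega> g t s g] path_prob_nonneg[OF \<epsilon>, of \<omega>]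
    by (force simp: Phi_def)
  have X0: "X None = 0" by (simp add: X_def IS_estimator_def)
  have X_nonneg: "0 \<le> X y" for y
    unfolding X_def IS_estimator_def using path_prob_nonneg[OF \<epsilon>] Q_nonneg[OF \<epsilon>]
    by (auto split: option.split simp: Phi_def indicator_def)
  have "((\<lambda>\<omega>. Q \<epsilon> \<omega> * X (Some \<omega>)) has_sum infsum (P \<epsilon>) (Phi s g t)) (absorbed_paths s g t)"
    by (rule has_sum_cong_neutral[THEN iffD1, OF _ _ _ has_sum_infsum[OF sum1]])
      (use sub Q0 in \<open>auto simp: X_def IS_estimator_def\<close>)
  then show "integrable M X" "integral\<^sup>L M X = infsum (P \<epsilon>) (Phi s g t)"
    unfolding M_def using Q_law_moment[where F = X, OF \<epsilon> X0 X_nonneg] by blast+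
  have "((\<lambda>\<omega>. Q \<epsilon> \<omega> * (X (Some \<omega>))\<^sup>2) has_sum infsum (\<lambda>\<omega>. (P \<epsilon> \<omega>)\<^sup>2 / Q \<epsilon> \<omega>) (Phi s g t))
      (absorbed_paths s g t)"
    by (rule has_sum_cong_neutral[THEN iffD1, OF _ _ _ has_sum_infsum[OF sum2]])
      (use sub in \<open>auto simp: X_def IS_estimator_def power2_eq_square\<close>)
  then show "integrable M (\<lambda>y. (X y)\<^sup>2)"
    "integral\<^sup>L M (\<lambda>y. (X y)\<^sup>2) = infsum (\<lambda>\<omega>. (P \<epsilon> \<omega>)\<^sup>2 / Q \<epsilon> \<omega>) (Phi s g t)"
    unfolding M_def using Q_law_moment[OF \<epsilon>, of "\<lambda>y. (X y)\<^sup>2"] X0 by auto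
qed

text \<open>The quotient equals \<open>M2 / M1\<^sup>2 - 1\<close>. Numerator and denominator are
  both scaled by \<open>\<epsilon> ^ (2 * goal_dist)\<close>, and \<open>c1 > 0\<close> yields the
  limit \<open>c2 / c1\<^sup>2 - 1\<close>.\<close>

lemma bounded_relative_error:
  "(\<forall>\<^sub>F \<epsilon> in at_right 0. integrable (Q_law p s g t v \<epsilon>) (\<lambda>y. (IS_estimator p s g t v \<epsilon> y)\<^sup>2)) \<and>
   is_bigO (\<lambda>\<epsilon>. prob_space.variance (Q_law p s g t v \<epsilon>) (IS_estimator p s g t v \<epsilon>) /
       (prob_space.expectation (Q_law p s g t v \<epsilon>) (IS_estimator p s g t v \<epsilon>))\<^sup>2) (\<lambda>_. 1)"
proof -
  define M1 where "M1 \<epsilon> = infsum (P \<epsilon>) (Phi s g t)" for \<epsilon>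
  define M2 where "M2 \<epsilon> = infsum (\<lambda>\<omega>. (P \<epsilon> \<omega>)\<^sup>2 / Q \<epsilon> \<omega>) (Phi s g t)" for \<epsilon>
  obtain \<kappa> where \<kappa>: "\<forall>\<^sub>F \<epsilon> in at_right 0. good \<kappa> \<epsilon>" by (rule eventually_good)
  obtain c1 where c1: "0 < c1" "((\<lambda>\<epsilon>. M1 \<epsilon> / \<epsilon> ^ goal_dist) \<longlongrightarrow> c1) (at_right 0)"
    "\<forall>\<^sub>F \<epsilon> in at_right 0. P \<epsilon> summable_on Phi s g t"
    unfolding M1_def by (rule first_moment_tendsto)
  obtain c2 where c2: "((\<lambda>\<epsilon>. M2 \<epsilon> / (\<epsilon> ^ goal_dist)\<^sup>2) \<longlongrightarrow> c2) (at_right 0)"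
    "\<forall>\<^sub>F \<epsilon> in at_right 0. (\<lambda>\<omega>. (P \<epsilon> \<omega>)\<^sup>2 / Q \<epsilon> \<omega>) summable_on Phi s g t"
    unfolding M2_def by (rule second_moment_tendsto)
  have ev: "\<forall>\<^sub>F \<epsilon> in at_right 0. integrable (Q_law p s g t v \<epsilon>) (\<lambda>y. (IS_estimator p s g t v \<epsilon> y)\<^sup>2) \<and>
      prob_space.variance (Q_law p s g t v \<epsilon>) (IS_estimator p s g t v \<epsilon>) /
        (prob_space.expectation (Q_law p s g t v \<epsilon>) (IS_estimator p s g t v \<epsilon>))\<^sup>2 =
      (M2 \<epsilon> - (M1 \<epsilon>)\<^sup>2) / (M1 \<epsilon>)\<^sup>2"
    using \<kappa> c1(3) c2(2)
  proof eventually_elim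
    case (elim \<epsilon>)
    interpret prob_space "Q_law p s g t v \<epsilon>"
      using elim by (intro prob_space_Q_law) (simp add: good_def)
    note m = estimator_moments[OF elim]
    from m variance_eq[OF m(1,3)] show ?case by (simp add: M1_def M2_def)
  qed
  have "((\<lambda>\<epsilon>. M2 \<epsilon> / (\<epsilon> ^ goal_dist)\<^sup>2 / (M1 \<epsilon> / \<epsilon> ^ goal_dist)\<^sup>2 - 1) \<longlongrightarrow> c2 / c1\<^sup>2 - 1) (at_right 0)"
    using c1(1) by (intro tendsto_intros c1(2) c2(1)) auto
  moreover have "\<forall>\<^sub>F \<epsilon> in at_right 0. M2 \<epsilon> / (\<epsilon> ^ goal_dist)\<^sup>2 / (M1 \<epsilon> / \<epsilon> ^ goal_dist)\<^sup>2 - 1 =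
      prob_space.variance (Q_law p s g t v \<epsilon>) (IS_estimator p s g t v \<epsilon>) /
       (prob_space.expectation (Q_law p s g t v \<epsilon>) (IS_estimator p s g t v \<epsilon>))\<^sup>2 / 1"
    using ev order_tendstoD(1)[OF c1(2,1)] eventually_at_right_less[of 0]
  proof eventually_elim
    case (elim \<epsilon>)
    then have "M2 \<epsilon> / (\<epsilon> ^ goal_dist)\<^sup>2 / (M1 \<epsilon> / \<epsilon> ^ goal_dist)\<^sup>2 - 1 = (M2 \<epsilon> - (M1 \<epsilon>)\<^sup>2) / (M1 \<epsilon>)\<^sup>2"
      by (auto simp: diff_divide_distrib power_divide)
    with elim show ?case by simp
  qed
  ultimately have "is_bigO (\<lambda>\<epsilon>. prob_space.variance (Q_law p s g t v \<epsilon>) (IS_estimator p s g t v \<epsilon>) /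
       (prob_space.expectation (Q_law p s g t v \<epsilon>) (IS_estimator p s g t v \<epsilon>))\<^sup>2) (\<lambda>_. 1)"
    unfolding is_bigO_def by (blast intro: Lim_transform_eventually)
  with ev show ?thesis by (auto elim: eventually_mono)
qed

end

theorem theorem4p5:
  fixes p :: "real \<Rightarrow> 'a :: countable \<Rightarrow> 'a \<Rightarrow> real"
    and \<epsilon>0 :: real
    and r :: "'a \<Rightarrow> 'a \<Rightarrow> enat"
    and s g t :: 'a
    and v :: "real \<Rightarrow> 'a \<Rightarrow> real"
  assumes "rare_event_chain p \<epsilon>0 r s g t"
    and "\<And>\<epsilon> x. \<epsilon> \<in> {0<..<\<epsilon>0} \<Longrightarrow> v \<epsilon> x \<ge> 0"
    and "uniform_Theta_pow (\<lambda>x \<epsilon>. v \<epsilon> x) (\<lambda>x. d_bar p s g t x g)"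
  shows "(\<forall>\<^sub>F \<epsilon> in at_right 0.
            integrable (Q_law p s g t v \<epsilon>) (\<lambda>y. (IS_estimator p s g t v \<epsilon> y)\<^sup>2))
       \<and> is_bigO (\<lambda>\<epsilon>. prob_space.variance (Q_law p s g t v \<epsilon>) (IS_estimator p s g t v \<epsilon>) /
                       (prob_space.expectation (Q_law p s g t v \<epsilon>) (IS_estimator p s g t v \<epsilon>))\<^sup>2)
                 (\<lambda>_. 1)"
proof -
  interpret importance_sampling p \<epsilon>0 r s g t v
    by (intro importance_sampling.intro importance_sampling_axioms.intro assms)
  show ?thesis by (rule bounded_relative_error)
qed

end
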